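(* Let $G=\mathbb Z/3\mathbb Z\star\mathbb Z/3\mathbb Z$, with $a$ and $b$ generators of the two factors, and $\Sigma=\{a,a^2,b,b^2\}$. Let $p\in[0,1/2]$ and let $\mu$ be the probability measure on $\Sigma$ with $\mu(a)=\mu(b)=p$ and $\mu(a^2)=\mu(b^2)=\tfrac12-p$. Then the drift of the random walk $(G,\mu)$ is $$\gamma=-\frac14+\frac14\sqrt{16p^2-8p+5}.$$ Moreover, if $p\neq\tfrac14$, the harmonic measure of $(G,\mu)$ is the Markovian multiplicative measure associated with $$r(a)=r(b)=\frac{4p-3+\sqrt{16p^2-8p+5}}{4(4p-1)},\qquad r(a^2)=r(b^2)=\frac{4p+1-\sqrt{16p^2-8p+5}}{4(4p-1)}.$$
   Context: Random walk $(G,\mu)$: $X_0=1$, $X_{n+1}=X_n\ast x_n$ with $(x_n)$ i.i.d. of law $\mu$. Elements of $G$ are identified with finite words over $\Sigma$ whose consecutive letters lie in different factors (set $L$, empty word $=1$); $|g|$ is the number of letters of $g$, i.e. the word length with respect to $\Sigma$. The drift is the a.s. constant limit $\gamma=\lim_n|X_n|/n$. Write $\Sigma_1=\{a,a^2\}$, $\Sigma_2=\{b,b^2\}$, and $\Sigma_u$ for the $\Sigma_i$ containing $u$. The harmonic measure is the law of the a.s. limit $X_\infty$ of $X_n$, an infinite word with alternating factors (the common prefix length of $X_n$ and $X_\infty$ tends to infinity). For $r\in\mathbb R^\Sigma$ with positive entries summing to $1$, and $r(S)=\sum_{u\in S}r(u)$, the Markovian multiplicative measure associated with $r$ gives to the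 cylinder $u_1\cdots u_k\Sigma^{\mathbb N}$ (for nonempty $u_1\cdots u_k\in L$) the mass $\frac{r(u_1)}{r(\Sigma\setminus\Sigma_{u_1})}\cdots\frac{r(u_{k-1})}{r(\Sigma\setminus\Sigma_{u_{k-1}})}r(u_k)$. *)

theory Defs
  imports
    "HOL-Probability.Probability"
    "HOL-Algebra.Elementary_Groups"
    "HOL-Library.Sublist"
begin

section \<open>Free products of groups\<close>

text \<open>
  The free product of a family of groups, realised on normal forms: a letter \<open>(i, u)\<close> is a
  non-trivial element \<open>u\<close> of the \<open>i\<close>-th factor, and a group element is a finite word of letters in
  which consecutive letters lie in different factors.
\<close>

definition fp_letters :: "('i \<Rightarrow> ('a, 'm) monoid_scheme) \<Rightarrow> ('i \<times> 'a) set" where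
  "fp_letters H = {(i, u). u \<in> carrier (H i) \<and> u \<noteq> \<one>\<^bsub>H i\<^esub>}"

definition fp_words :: "('i \<Rightarrow> ('a, 'm) monoid_scheme) \<Rightarrow> ('i \<times> 'a) list set" where
  "fp_words H =
     {w. set w \<subseteq> fp_letters H \<and> successively (\<lambda>x y. fst x \<noteq> fst y) w}"

text \<open>Left multiplication of a normal form by a letter.\<close>

fun fp_lmult :: "('i \<Rightarrow> ('a, 'm) monoid_scheme) \<Rightarrow> 'i \<times> 'a \<Rightarrow> ('i \<times> 'a) list \<Rightarrow> ('i \<times> 'a) list"
where
  "fp_lmult H (i, u) [] = [(i, u)]"
| "fp_lmult H (i, u) ((j, v) # w) =
     (if i = j
      then (if u \<otimes>\<^bsub>H i\<^esub> v = \<one>\<^bsub>H i\<^esub> then w else (i, u \<otimes>\<^bsub>H i\<^esub> v) # w)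
      else (i, u) # (j, v) # w)"

definition free_product :: "('i \<Rightarrow> ('a, 'm) monoid_scheme) \<Rightarrow> ('i \<times> 'a) list monoid" where
  "free_product H =
     \<lparr>carrier = fp_words H, mult = (\<lambda>g h. foldr (fp_lmult H) g h), one = []\<rparr>"

definition fp_inj :: "('i \<Rightarrow> ('a, 'm) monoid_scheme) \<Rightarrow> 'i \<Rightarrow> 'a \<Rightarrow> ('i \<times> 'a) list" where
  "fp_inj H i u = (if u = \<one>\<^bsub>H i\<^esub> then [] else [(i, u)])"

lemma free_product_simps [simp]:
  "carrier (free_product H) = fp_words H"
  "g \<otimes>\<^bsub>free_product H\<^esub> h = foldr (fp_lmult H) g h"
  "\<one>\<^bsub>free_product H\<^esub> = []"
  by (simp_all add: free_product_def)

lemma fp_words_Nil [simp]: "[] \<in> fp_words H"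
  by (simp add: fp_words_def)

lemma fp_words_Cons:
  "x # w \<in> fp_words H \<longleftrightarrow>
     x \<in> fp_letters H \<and> w \<in> fp_words H \<and> (w = [] \<or> fst x \<noteq> fst (hd w))"
  by (auto simp: fp_words_def successively_Cons)

lemma fp_lmult_closed:
  assumes "\<And>i. group (H i)" "x \<in> fp_letters H" "w \<in> fp_words H"
  shows "fp_lmult H x w \<in> fp_words H"
proof -
  obtain i u where x: "x = (i, u)" by (cases x)
  interpret group "H i" by (rule assms(1))
  show ?thesis
    using assms(2,3) unfolding x
    by (cases w) (auto simp: fp_words_Cons fp_letters_def)
qed

lemma fp_mult_closed:
  assumes "\<And>i. group (H i)" "g \<in> fp_words H" "h \<in> fp_words H"
  shows "foldr (fp_lmult H) g h \<in> fp_words H"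
  using assms(2) by (induction g) (auto simp: fp_words_Cons assms fp_lmult_closed)

lemma fp_mult_Nil: "g \<in> fp_words H \<Longrightarrow> foldr (fp_lmult H) g [] = g"
proof (induction g)
  case (Cons x g)
  then have "foldr (fp_lmult H) g [] = g" by (simp add: fp_words_Cons)
  with Cons.prems show ?case
    by (cases x; cases g) (auto simp: fp_words_Cons)
qed simp

lemma fp_lmult_lmult:
  assumes "\<And>i. group (H i)" "(i, u) \<in> fp_letters H" "(i, v) \<in> fp_letters H" "w \<in> fp_words H"
  shows "fp_lmult H (i, u) (fp_lmult H (i, v) w) =
    (if u \<otimes>\<^bsub>H i\<^esub> v = \<one>\<^bsub>H i\<^esub> then w else fp_lmult H (i, u \<otimes>\<^bsub>H i\<^esub> v) w)"
proof -
  interpret group "H i" by (rule assms(1))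
  have uv: "u \<in> carrier (H i)" "v \<in> carrier (H i)"
    using assms(2,3) by (auto simp: fp_letters_def)
  show ?thesis
  proof (cases "w \<noteq> [] \<and> fst (hd w) = i")
    case False
    then show ?thesis by (cases w) auto
  next
    case True
    then obtain t w' where w: "w = (i, t) # w'" by (cases w) auto
    have t: "t \<in> carrier (H i)" "t \<noteq> \<one>\<^bsub>H i\<^esub>"
      using assms(4) by (auto simp: w fp_words_Cons fp_letters_def)
    have w': "w' = [] \<or> fst (hd w') \<noteq> i"
      using assms(4) by (auto simp: w fp_words_Cons)
    have push: "fp_lmult H (i, s) w' = (i, s) # w'" for s
      using w' by (cases w') auto
    have assoc: "u \<otimes>\<^bsub>H i\<^esub> (v \<otimes>\<^bsub>H i\<^esub> t) = (u \<otimes>\<^bsub>H i\<^esub> v) \<otimes>\<^bsub>H i\<^esub> t"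
      using uv t by (simp add: m_assoc)
    have 1: "u = (u \<otimes>\<^bsub>H i\<^esub> v) \<otimes>\<^bsub>H i\<^esub> t" if "v \<otimes>\<^bsub>H i\<^esub> t = \<one>\<^bsub>H i\<^esub>"
      using assoc that uv by simp
    have 2: "u \<noteq> \<one>\<^bsub>H i\<^esub>"
      using assms(2) by (auto simp: fp_letters_def)
    show ?thesis
    proof (cases "v \<otimes>\<^bsub>H i\<^esub> t = \<one>\<^bsub>H i\<^esub>")
      case True
      show ?thesis
      proof (cases "u \<otimes>\<^bsub>H i\<^esub> v = \<one>\<^bsub>H i\<^esub>")
        case uv1: True
        have "u = t" using 1[OF True] uv1 t by simp
        then show ?thesis using True uv1 by (simp add: w push)
      next
        case False
        then show ?thesis using True 1[OF True, symmetric] 2 by (simp add: w push)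
      qed
    next
      case False
      then show ?thesis using assoc t by (simp add: w)
    qed
  qed
qed

lemma fp_lmult_mult:
  assumes "\<And>i. group (H i)" "x \<in> fp_letters H" "h \<in> fp_words H" "k \<in> fp_words H"
  shows "foldr (fp_lmult H) (fp_lmult H x h) k = fp_lmult H x (foldr (fp_lmult H) h k)"
proof (cases h)
  case Nil
  then show ?thesis by (cases x) simp
next
  case (Cons y h')
  obtain i u where x: "x = (i, u)" by (cases x)
  obtain j v where y: "y = (j, v)" by (cases y)
  have y': "(j, v) \<in> fp_letters H" "h' \<in> fp_words H"
    using assms(3) by (auto simp: Cons y fp_words_Cons)
  then have h'k: "foldr (fp_lmult H) h' k \<in> fp_words H"
    using fp_mult_closed assms(1,4) by blast
  show ?thesis
    using fp_lmult_lmult[of H i u v "foldr (fp_lmult H) h' k"] assms(1,2) y' h'k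
    by (auto simp: Cons x y)
qed

lemma fp_mult_assoc:
  assumes "\<And>i. group (H i)" "g \<in> fp_words H" "h \<in> fp_words H" "k \<in> fp_words H"
  shows "foldr (fp_lmult H) (foldr (fp_lmult H) g h) k =
    foldr (fp_lmult H) g (foldr (fp_lmult H) h k)"
  using assms(2)
proof (induction g)
  case (Cons x g)
  then show ?case
    using fp_lmult_mult[of H x "foldr (fp_lmult H) g h" k] fp_mult_closed[of H g h] assms
    by (simp add: fp_words_Cons)
qed simp

theorem group_free_product:
  assumes H: "\<And>i. group (H i)"
  shows "group (free_product H)"
proof (rule groupI)
  fix g assume "g \<in> carrier (free_product H)"
  then have "g \<in> fp_words H" by simp
  then have "\<exists>h \<in> fp_words H. foldr (fp_lmult H) h g = []"
  proof (induction g)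
    case Nil
    show ?case by (rule bexI[of _ "[]"]) auto
  next
    case (Cons x g)
    obtain i u where x: "x = (i, u)" by (cases x)
    interpret group "H i" by (rule H)
    obtain h where h: "h \<in> fp_words H" "foldr (fp_lmult H) h g = []"
      using Cons by (auto simp: fp_words_Cons)
    let ?y = "(i, inv\<^bsub>H i\<^esub> u)"
    have u: "u \<in> carrier (H i)" "u \<noteq> \<one>\<^bsub>H i\<^esub>"
      using Cons.prems by (auto simp: x fp_words_Cons fp_letters_def)
    then have y: "?y \<in> fp_letters H"
      by (auto simp: fp_letters_def inv_eq_1_iff)
    then have y': "[?y] \<in> fp_words H" by (simp add: fp_words_Cons)
    have "foldr (fp_lmult H) (foldr (fp_lmult H) h [?y]) (x # g) =
      foldr (fp_lmult H) h (foldr (fp_lmult H) [?y] (x # g))"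
      by (rule fp_mult_assoc) (use H h(1) y' Cons.prems in auto)
    also have "foldr (fp_lmult H) [?y] (x # g) = g" using u by (simp add: x)
    finally show ?case
      using h fp_mult_closed[OF H h(1) y'] by auto
  qed
  then show "\<exists>h \<in> carrier (free_product H). h \<otimes>\<^bsub>free_product H\<^esub> g = \<one>\<^bsub>free_product H\<^esub>"
    by simp
qed (use H in \<open>auto simp: fp_mult_closed fp_mult_assoc\<close>)

text \<open>The universal property of the free product.\<close>

lemma hom_fp_inj:
  assumes "\<And>i. group (H i)"
  shows "fp_inj H i \<in> hom (H i) (free_product H)"
proof -
  interpret group "H i" by (rule assms)
  show ?thesis
    by (rule homI) (auto simp: fp_inj_def fp_words_Cons fp_letters_def)
qed

theorem free_product_universal:
  assumes H: "\<And>i. group (H i)" and K: "group K" and f: "\<And>i. f i \<in> hom (H i) K"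
  shows "\<exists>F \<in> hom (free_product H) K. \<forall>i. \<forall>u \<in> carrier (H i). F (fp_inj H i u) = f i u"
    and "\<lbrakk>F \<in> hom (free_product H) K; \<forall>i. \<forall>u \<in> carrier (H i). F (fp_inj H i u) = f i u;
          F' \<in> hom (free_product H) K; \<forall>i. \<forall>u \<in> carrier (H i). F' (fp_inj H i u) = f i u;
          g \<in> carrier (free_product H)\<rbrakk> \<Longrightarrow> F g = F' g"
proof -
  interpret K: group K by (rule K)
  have f_closed: "f i u \<in> carrier K" if "u \<in> carrier (H i)" for i u
    using f that by (auto simp: hom_def)
  have f_mult: "f i (u \<otimes>\<^bsub>H i\<^esub> v) = f i u \<otimes>\<^bsub>K\<^esub> f i v"
    if "u \<in> carrier (H i)" "v \<in> carrier (H i)" for i u v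
    using f that by (auto simp: hom_def)
  have f_one: "f i \<one>\<^bsub>H i\<^esub> = \<one>\<^bsub>K\<^esub>" for i
    using f H K hom_one by blast
  define F where "F = (\<lambda>w. foldr (\<lambda>x k. f (fst x) (snd x) \<otimes>\<^bsub>K\<^esub> k) w \<one>\<^bsub>K\<^esub>)"
  have F_simps: "F [] = \<one>\<^bsub>K\<^esub>" "F (x # w) = f (fst x) (snd x) \<otimes>\<^bsub>K\<^esub> F w" for x w
    by (auto simp: F_def)
  have F_closed: "F w \<in> carrier K" if "w \<in> fp_words H" for w
    using that by (induction w) (auto simp: F_simps fp_words_Cons fp_letters_def f_closed)
  have F_lmult: "F (fp_lmult H x w) = f (fst x) (snd x) \<otimes>\<^bsub>K\<^esub> F w"
    if "x \<in> fp_letters H" "w \<in> fp_words H" for x w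
  proof (cases "w \<noteq> [] \<and> fst (hd w) = fst x")
    case False
    then show ?thesis by (cases x; cases w) (auto simp: F_simps)
  next
    case True
    obtain i u where x: "x = (i, u)" by (cases x)
    with True obtain v w' where w: "w = (i, v) # w'" by (cases w) auto
    have m: "u \<in> carrier (H i)" "v \<in> carrier (H i)" "w' \<in> fp_words H"
      using that by (auto simp: x w fp_words_Cons fp_letters_def)
    have "f i u \<otimes>\<^bsub>K\<^esub> (f i v \<otimes>\<^bsub>K\<^esub> F w') = f i (u \<otimes>\<^bsub>H i\<^esub> v) \<otimes>\<^bsub>K\<^esub> F w'"
      using m by (simp add: f_mult f_closed F_closed K.m_assoc)
    then show ?thesis
      using m by (auto simp: x w F_simps f_one F_closed)
  qed
  have "F (foldr (fp_lmult H) g h) = F g \<otimes>\<^bsub>K\<^esub> F h"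
    if "g \<in> fp_words H" "h \<in> fp_words H" for g h
    using that(1)
  proof (induction g)
    case Nil
    then show ?case using that(2) by (simp add: F_simps F_closed)
  next
    case (Cons x g)
    then have "x \<in> fp_letters H" "g \<in> fp_words H" by (auto simp: fp_words_Cons)
    moreover from this have "f (fst x) (snd x) \<in> carrier K"
      by (auto simp: fp_letters_def f_closed)
    ultimately show ?case
      using Cons.IH that(2) by (simp add: F_simps F_lmult F_closed fp_mult_closed[OF H] K.m_assoc)
  qed
  then have "F \<in> hom (free_product H) K"
    by (intro homI) (auto simp: F_closed)
  moreover have "\<forall>i. \<forall>u \<in> carrier (H i). F (fp_inj H i u) = f i u"
    by (auto simp: fp_inj_def F_simps f_one f_closed)
  ultimately show
    "\<exists>F \<in> hom (free_product H) K. \<forall>i. \<forall>u \<in> carrier (H i). F (fp_inj H i u) = f i u"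
    by blast
next
  assume F: "F \<in> hom (free_product H) K" "\<forall>i. \<forall>u \<in> carrier (H i). F (fp_inj H i u) = f i u"
    and F': "F' \<in> hom (free_product H) K" "\<forall>i. \<forall>u \<in> carrier (H i). F' (fp_inj H i u) = f i u"
    and g: "g \<in> carrier (free_product H)"
  from g have "g \<in> fp_words H" by simp
  then show "F g = F' g"
  proof (induction g)
    case Nil
    show ?case
      using hom_one[OF F(1) group_free_product K] hom_one[OF F'(1) group_free_product K] H
      by simp
  next
    case (Cons x g)
    obtain i u where x: "x = (i, u)" by (cases x)
    have g: "g \<in> fp_words H" and u: "u \<in> carrier (H i)" "u \<noteq> \<one>\<^bsub>H i\<^esub>"
      using Cons.prems by (auto simp: x fp_words_Cons fp_letters_def)
    have s: "fp_inj H i u = [x]" "[x] \<in> fp_words H"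
      using u Cons.prems by (auto simp: fp_inj_def x fp_words_Cons)
    have "x # g = [x] \<otimes>\<^bsub>free_product H\<^esub> g"
      using Cons.prems by (cases g) (auto simp: x fp_words_Cons)
    moreover have "F ([x] \<otimes>\<^bsub>free_product H\<^esub> g) = F [x] \<otimes>\<^bsub>K\<^esub> F g"
      using hom_mult[OF F(1), of "[x]" g] s(2) g by simp
    moreover have "F' ([x] \<otimes>\<^bsub>free_product H\<^esub> g) = F' [x] \<otimes>\<^bsub>K\<^esub> F' g"
      using hom_mult[OF F'(1), of "[x]" g] s(2) g by simp
    moreover have "F [x] = F' [x]"
      using F(2) F'(2) u s(1) by metis
    ultimately show ?case using Cons.IH[OF g] by simp
  qed
qed

abbreviation Z3 :: "int monoid" where
  "Z3 \<equiv> integer_mod_group 3"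

text \<open>Factor 1 is indexed by \<open>False\<close>, factor 2 by \<open>True\<close>.\<close>

abbreviation Z3_Z3 :: "(bool \<times> int) list monoid" where
  "Z3_Z3 \<equiv> free_product (\<lambda>_. Z3)"


section \<open>Random walks on groups\<close>

definition random_walk_steps :: "'w measure \<Rightarrow> 'g pmf \<Rightarrow> (nat \<Rightarrow> 'w \<Rightarrow> 'g) \<Rightarrow> bool" where
  "random_walk_steps M \<mu> x \<longleftrightarrow>
     prob_space M \<and>
     prob_space.indep_vars M (\<lambda>_. count_space UNIV) x UNIV \<and>
     (\<forall>n. distr M (count_space UNIV) (x n) = measure_pmf \<mu>)"

fun walk :: "('g, 'm) monoid_scheme \<Rightarrow> (nat \<Rightarrow> 'w \<Rightarrow> 'g) \<Rightarrow> nat \<Rightarrow> 'w \<Rightarrow> 'g" where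
  "walk G x 0 \<omega> = \<one>\<^bsub>G\<^esub>"
| "walk G x (Suc n) \<omega> = walk G x n \<omega> \<otimes>\<^bsub>G\<^esub> x n \<omega>"

definition has_drift :: "'w measure \<Rightarrow> (nat \<Rightarrow> 'w \<Rightarrow> 'l list) \<Rightarrow> real \<Rightarrow> bool" where
  "has_drift M X \<gamma> \<longleftrightarrow>
     (AE \<omega> in M. (\<lambda>n. real (length (X n \<omega>)) / real n) \<longlonglongrightarrow> \<gamma>)"


section \<open>Infinite words, harmonic measure, multiplicative measures\<close>

definition common_prefix_length :: "'l list \<Rightarrow> 'l stream \<Rightarrow> nat" where
  "common_prefix_length w \<xi> = length (longest_common_prefix w (stake (length w) \<xi>))"

definition word_limit :: "(nat \<Rightarrow> 'l list) \<Rightarrow> 'l stream \<Rightarrow> bool" where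
  "word_limit w \<xi> \<longleftrightarrow> filterlim (\<lambda>n. common_prefix_length (w n) \<xi>) at_top sequentially"

definition infinite_words :: "'l set \<Rightarrow> 'l stream measure" where
  "infinite_words S = stream_space (count_space S)"

text \<open>The law \<open>\<nu>\<close> of an almost sure limit, in the space of infinite words over \<open>S\<close>, of the random
  words \<open>X n\<close>. Such limits agree almost surely, so there is at most one such \<open>\<nu>\<close>.\<close>

definition harmonic_measure ::
  "'w measure \<Rightarrow> 'l set \<Rightarrow> (nat \<Rightarrow> 'w \<Rightarrow> 'l list) \<Rightarrow> 'l stream measure \<Rightarrow> bool" where
  "harmonic_measure M S X \<nu> \<longleftrightarrow>
     (\<exists>X_inf \<in> M \<rightarrow>\<^sub>M infinite_words S.
        (AE \<omega> in M. word_limit (\<lambda>n. X n \<omega>) (X_inf \<omega>)) \<and>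
        \<nu> = distr M (infinite_words S) X_inf)"

definition cylinder :: "'l set \<Rightarrow> 'l list \<Rightarrow> 'l stream set" where
  "cylinder S w = {\<xi> \<in> streams S. stake (length w) \<xi> = w}"

definition mm_weight :: "('i \<times> 'a) set \<Rightarrow> ('i \<times> 'a \<Rightarrow> real) \<Rightarrow> ('i \<times> 'a) list \<Rightarrow> real" where
  "mm_weight S r w =
     (\<Prod>j<length w - 1. r (w ! j) / (\<Sum>v | v \<in> S \<and> fst v \<noteq> fst (w ! j). r v)) * r (last w)"

text \<open>The cylinder masses of words of length 1 sum to 1, so \<open>\<nu>\<close> is a probability measure and is
  determined by the condition below, all cylinders of non-alternating words being null.\<close>

definition markovian_multiplicative ::
  "('i \<times> 'a) set \<Rightarrow> ('i \<times> 'a \<Rightarrow> real) \<Rightarrow> ('i \<times> 'a) stream measure \<Rightarrow> bool" where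
  "markovian_multiplicative S r \<nu> \<longleftrightarrow>
     (\<forall>u\<in>S. r u > 0) \<and> (\<Sum>u\<in>S. r u) = 1 \<and>
     sets \<nu> = sets (infinite_words S) \<and>
     (\<forall>w. w \<noteq> [] \<and> set w \<subseteq> S \<and> successively (\<lambda>x y. fst x \<noteq> fst y) w \<longrightarrow>
        emeasure \<nu> (cylinder S w) = ennreal (mm_weight S r w))"

end

theory Submission
  imports Defs "HOL-Library.Discrete_Functions"
begin

text \<open>
  Let \<open>c s = 1/2 + \<mu>(s)\<close>. Away from the identity the sum of \<open>c\<close> over the letters of \<open>X\<^sub>n\<close> has the
  constant conditional drift \<open>D = 1/4 - p (1/2 - p) > 0\<close>, so it grows like \<open>D n\<close>; hence the walk is
  transient and converges to an infinite word. For every cylinder, the mass that the translate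
  by \<open>g\<close> of the multiplicative measure gives to it is an explicit bounded harmonic
  function of \<open>g\<close>, whose value along the walk converges to the indicator of the event that the
  limit word lies in the cylinder; this identifies the harmonic measure. In particular, the
  letters of the limit word have independent types, so the mean of \<open>c\<close> over its prefixes tends to a
  constant \<open>\<kappa>\<close>, and since \<open>X\<^sub>n\<close> agrees with the limit word up to \<open>o(n)\<close> letters, \<open>|X\<^sub>n| / n\<close> tends to
  \<open>D / \<kappa>\<close>. Limit theorems are only needed for bounded orthogonal variables.
\<close>

text \<open>The length of the walk has a conditional drift that depends on the last letter; this is
  why letters are weighted. With \<open>c s = x + y * \<mu>(s)\<close>, the contribution of the
  factor of the last letter no longer depends on that letter as soon as \<open>x = y / 2\<close>,
  which leads to \<open>1/2 + \<mu>(s)\<close> up to scaling. The constant \<open>\<kappa>\<close>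
  has two roles. It is the proportionality factor in the stationarity equation
  \<open>wt s + wt (bar s) * R (bar s) = \<kappa> * R s\<close>, which makes the cylinder functions
  harmonic, and summing this equation over a factor shows that it is also the mean of
  \<open>c\<close> under \<open>R\<close>. With \<open>s = sqrt (16 * p\<^sup>2 - 8 * p + 5)\<close>
  one gets \<open>\<kappa> = (1 + s) / 4\<close> and \<open>D = (s\<^sup>2 - 1) / 16\<close>, so
  that \<open>D / \<kappa> = (s - 1) / 4\<close>. The formulas for \<open>r\<close> become 0/0 at
  \<open>p = 1/4\<close>, where the drift is still claimed. The argument is therefore run with the
  rationalised weights \<open>R a = 2 / (3 - 4 * p + s)\<close> and
  \<open>R a2 = 2 / (1 + 4 * p + s)\<close>, and \<open>r = R / 2\<close> is matched only at the
  end.\<close>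

section \<open>Averages of bounded orthogonal random variables\<close>

text \<open>Above \<open>m\<^sup>2\<close> there are at most \<open>2 * m\<close> further indices
  before the next square, so bounded increments move \<open>S\<close> by \<open>O(m)\<close>, which
  is negligible against \<open>m\<^sup>2\<close>.\<close>

lemma averages_tendsto_zero_from_squares:
  fixes S :: "nat \<Rightarrow> real"
  assumes step: "\<And>n. \<bar>S (Suc n) - S n\<bar> \<le> C"
    and sq: "(\<lambda>m. S (m\<^sup>2) / real (m\<^sup>2)) \<longlonglongrightarrow> 0"
  shows "(\<lambda>n. S n / real n) \<longlonglongrightarrow> 0"
proof -
  have C: "0 \<le> C" using step[of 0] by linarith
  have gap: "\<bar>S (m + k) - S m\<bar> \<le> real k * C" for m k
  proof (induction k)
    case (Suc k)
    have "\<bar>S (m + Suc k) - S m\<bar> \<le> \<bar>S (m + k) - S m\<bar> + \<bar>S (Suc (m + k)) - S (m + k)\<bar>" by simp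
    also have "\<dots> \<le> real k * C + C" using Suc step by (intro add_mono)
    finally show ?case by (simp add: algebra_simps)
  qed simp
  define m where "m n = floor_sqrt n" for n
  have m_lim: "filterlim m at_top sequentially"
    unfolding filterlim_at_top eventually_sequentially
  proof (intro allI exI impI)
    fix Z n :: nat assume "Z\<^sup>2 \<le> n"
    then show "Z \<le> m n" by (simp add: m_def le_floor_sqrt_iff)
  qed
  have bound: "\<bar>S n / real n\<bar> \<le> \<bar>S ((m n)\<^sup>2) / real ((m n)\<^sup>2)\<bar> + 2 * C / real (m n)" if "0 < n" for n
  proof -
    have m1: "(m n)\<^sup>2 \<le> n" "n < (Suc (m n))\<^sup>2"
      unfolding m_def by (auto simp: Suc_floor_sqrt_power2_gt)
    have m0: "0 < m n" using that by (simp add: m_def)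
    obtain k where k: "n = (m n)\<^sup>2 + k" using m1(1) le_Suc_ex by blast
    have k2: "k \<le> 2 * m n" using m1(2) k by (simp add: power2_eq_square)
    have "\<bar>S n\<bar> \<le> \<bar>S ((m n)\<^sup>2)\<bar> + real k * C"
    proof -
      have "\<bar>S n - S ((m n)\<^sup>2)\<bar> \<le> real k * C" using gap[of "(m n)\<^sup>2" k] by (simp only: k[symmetric])
      then show ?thesis by linarith
    qed
    also have "\<dots> \<le> \<bar>S ((m n)\<^sup>2)\<bar> + real (2 * m n) * C"
      using k2 C by (intro add_left_mono mult_right_mono) (auto simp del: of_nat_mult)
    finally have "\<bar>S n\<bar> / real n \<le> (\<bar>S ((m n)\<^sup>2)\<bar> + 2 * real (m n) * C) / real n"
      by (intro divide_right_mono) auto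
    also have "\<dots> \<le> (\<bar>S ((m n)\<^sup>2)\<bar> + 2 * real (m n) * C) / real ((m n)\<^sup>2)"
      using m1(1) m0 C by (intro divide_left_mono) (auto simp del: of_nat_power simp: that)
    also have "\<dots> = \<bar>S ((m n)\<^sup>2)\<bar> / real ((m n)\<^sup>2) + 2 * C / real (m n)"
      using m0 by (simp add: field_simps power2_eq_square)
    finally show ?thesis by simp
  qed
  have "(\<lambda>n. \<bar>S ((m n)\<^sup>2) / real ((m n)\<^sup>2)\<bar> + 2 * C / real (m n)) \<longlonglongrightarrow> 0 + 0"
  proof (rule tendsto_add)
    show "(\<lambda>n. \<bar>S ((m n)\<^sup>2) / real ((m n)\<^sup>2)\<bar>) \<longlonglongrightarrow> 0"
      using filterlim_compose[OF sq m_lim] by (rule tendsto_rabs_zero)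
    show "(\<lambda>n. 2 * C / real (m n)) \<longlonglongrightarrow> 0"
      by (intro real_tendsto_divide_at_top[OF tendsto_const]
          filterlim_compose[OF filterlim_real_sequentially m_lim])
  qed
  then have "(\<lambda>n. \<bar>S ((m n)\<^sup>2) / real ((m n)\<^sup>2)\<bar> + 2 * C / real (m n)) \<longlonglongrightarrow> 0"
    by simp
  then show ?thesis
    by (rule Lim_null_comparison[rotated])
      (use bound in \<open>auto intro!: eventually_sequentiallyI[of 1] simp only: real_norm_def\<close>)
qed

context prob_space
begin

text \<open>Orthogonality keeps the second moment of the n-th sum below
  \<open>n * C\<^sup>2\<close>. Along the squares the averages thus have summable second moments and
  tend to 0 almost surely; bounded increments fill the gaps.\<close>

lemma bounded_orthogonal_averages_tendsto_zero:
  fixes X :: "nat \<Rightarrow> 'a \<Rightarrow> real"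
  assumes X[measurable]: "\<And>n. random_variable borel (X n)"
    and bd: "\<And>n \<omega>. \<bar>X n \<omega>\<bar> \<le> C"
    and orth: "\<And>i j. i < j \<Longrightarrow> expectation (\<lambda>\<omega>. X i \<omega> * X j \<omega>) = 0"
  shows "AE \<omega> in M. (\<lambda>n. (\<Sum>i<n. X i \<omega>) / real n) \<longlonglongrightarrow> 0"
proof -
  have C: "0 \<le> C" using bd[of 0 undefined] by linarith
  define S where "S n \<omega> = (\<Sum>i<n. X i \<omega>)" for n \<omega>
  have S[measurable]: "random_variable borel (S n)" for n
    unfolding S_def by measurable
  have S_bd: "\<bar>S n \<omega>\<bar> \<le> real n * C" for n \<omega>
  proof -
    have "\<bar>S n \<omega>\<bar> \<le> (\<Sum>i<n. \<bar>X i \<omega>\<bar>)" unfolding S_def by (rule sum_abs)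
    also have "\<dots> \<le> (\<Sum>i<n. C)" by (intro sum_mono bd)
    finally show ?thesis by simp
  qed
  have intX: "integrable M (\<lambda>\<omega>. X i \<omega> * X j \<omega>)" for i j
    using bd by (intro integrable_const_bound[where B = "C * C"])
      (auto simp: abs_mult intro!: mult_mono C)
  have intS: "integrable M (\<lambda>\<omega>. (S n \<omega>)\<^sup>2)" for n
    using S_bd by (intro integrable_const_bound[where B = "(real n * C)\<^sup>2"])
      (auto intro!: power2_le_iff_abs_le[THEN iffD2] simp: C)
  have var: "expectation (\<lambda>\<omega>. (S n \<omega>)\<^sup>2) \<le> real n * C\<^sup>2" for n
  proof (induction n)
    case 0
    show ?case by (simp add: S_def)
  next
    case (Suc n)
    have eq: "(S (Suc n) \<omega>)\<^sup>2 = (S n \<omega>)\<^sup>2 + (2 * (\<Sum>i<n. X i \<omega> * X n \<omega>) + X n \<omega> * X n \<omega>)" for \<omega>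
      by (simp add: S_def power2_eq_square algebra_simps sum_distrib_left sum_distrib_right)
    have "expectation (\<lambda>\<omega>. (S (Suc n) \<omega>)\<^sup>2) =
        expectation (\<lambda>\<omega>. (S n \<omega>)\<^sup>2) + (2 * (\<Sum>i<n. expectation (\<lambda>\<omega>. X i \<omega> * X n \<omega>))
          + expectation (\<lambda>\<omega>. X n \<omega> * X n \<omega>))"
      unfolding eq using intX intS by simp
    also have "(\<Sum>i<n. expectation (\<lambda>\<omega>. X i \<omega> * X n \<omega>)) = 0"
      using orth by (intro sum.neutral) auto
    also have "expectation (\<lambda>\<omega>. X n \<omega> * X n \<omega>) \<le> expectation (\<lambda>\<omega>. C\<^sup>2)"
    proof (intro integral_mono intX)
      show "X n \<omega> * X n \<omega> \<le> C\<^sup>2" for \<omega>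
        using bd[of n \<omega>] C abs_le_square_iff[of "X n \<omega>" C] by (simp add: power2_eq_square)
    qed auto
    finally show ?case using Suc by (simp add: algebra_simps prob_space)
  qed
  have "(\<integral>\<^sup>+\<omega>. (\<Sum>m. ennreal ((S ((Suc m)\<^sup>2) \<omega> / real ((Suc m)\<^sup>2))\<^sup>2)) \<partial>M) =
      (\<Sum>m. \<integral>\<^sup>+\<omega>. ennreal ((S ((Suc m)\<^sup>2) \<omega> / real ((Suc m)\<^sup>2))\<^sup>2) \<partial>M)"
    by (intro nn_integral_suminf) auto
  also have "\<dots> \<le> (\<Sum>m. ennreal (C\<^sup>2 * (1 / real ((Suc m)\<^sup>2))))"
  proof (intro suminf_le)
    fix m
    let ?N = "(Suc m)\<^sup>2"
    have "(\<integral>\<^sup>+\<omega>. ennreal ((S ?N \<omega> / real ?N)\<^sup>2) \<partial>M) =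
        ennreal (expectation (\<lambda>\<omega>. (S ?N \<omega> / real ?N)\<^sup>2))"
      using intS[of ?N] by (intro nn_integral_eq_integral) (auto simp: power_divide)
    also have "expectation (\<lambda>\<omega>. (S ?N \<omega> / real ?N)\<^sup>2) = expectation (\<lambda>\<omega>. (S ?N \<omega>)\<^sup>2) / (real ?N)\<^sup>2"
      by (simp add: power_divide del: of_nat_power)
    also have "\<dots> \<le> real ?N * C\<^sup>2 / (real ?N)\<^sup>2"
      by (intro divide_right_mono var) auto
    also have "\<dots> = C\<^sup>2 * (1 / real ?N)"
      by (simp add: power2_eq_square del: of_nat_mult)
    finally show "(\<integral>\<^sup>+\<omega>. ennreal ((S ?N \<omega> / real ?N)\<^sup>2) \<partial>M) \<le> ennreal (C\<^sup>2 * (1 / real ?N))"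
      by (simp add: ennreal_leI)
  qed auto
  also have "\<dots> < \<infinity>"
  proof -
    have "summable (\<lambda>m. C\<^sup>2 * (1 / real ((Suc m)\<^sup>2)))"
      using inverse_power_summable[of 2, where 'a = real]
      by (intro summable_mult) (subst summable_Suc_iff, simp add: field_simps)
    then show ?thesis
      by (subst suminf_ennreal2) auto
  qed
  finally have "AE \<omega> in M. (\<Sum>m. ennreal ((S ((Suc m)\<^sup>2) \<omega> / real ((Suc m)\<^sup>2))\<^sup>2)) \<noteq> \<infinity>"
    by (intro nn_integral_noteq_infinite) auto
  then show ?thesis
  proof (rule AE_mp, intro AE_I2 impI)
    fix \<omega> assume "(\<Sum>m. ennreal ((S ((Suc m)\<^sup>2) \<omega> / real ((Suc m)\<^sup>2))\<^sup>2)) \<noteq> \<infinity>"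
    then have "summable (\<lambda>m. (S ((Suc m)\<^sup>2) \<omega> / real ((Suc m)\<^sup>2))\<^sup>2)"
      by (intro summable_suminf_not_top) auto
    then have "(\<lambda>m. (S ((Suc m)\<^sup>2) \<omega> / real ((Suc m)\<^sup>2))\<^sup>2) \<longlonglongrightarrow> 0"
      by (rule summable_LIMSEQ_zero)
    then have "(\<lambda>m. sqrt ((S ((Suc m)\<^sup>2) \<omega> / real ((Suc m)\<^sup>2))\<^sup>2)) \<longlonglongrightarrow> sqrt 0"
      by (rule tendsto_real_sqrt)
    then have "(\<lambda>m. S ((Suc m)\<^sup>2) \<omega> / real ((Suc m)\<^sup>2)) \<longlonglongrightarrow> 0"
      unfolding real_sqrt_abs real_sqrt_zero by (rule tendsto_rabs_zero_cancel)
    then have "(\<lambda>m. S (m\<^sup>2) \<omega> / real (m\<^sup>2)) \<longlonglongrightarrow> 0"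
      by (rule LIMSEQ_imp_Suc)
    then have "(\<lambda>n. S n \<omega> / real n) \<longlonglongrightarrow> 0"
      by (rule averages_tendsto_zero_from_squares[where C = C, rotated]) (simp add: S_def bd)
    then show "(\<lambda>n. (\<Sum>i<n. X i \<omega>) / real n) \<longlonglongrightarrow> 0"
      by (simp add: S_def)
  qed
qed

end

section \<open>Normal forms and harmonic functions\<close>

definition letters :: "(bool \<times> int) set" where
  "letters = UNIV \<times> {1, 2}"

text \<open>In \<open>Z3\<close> the inverse of a letter is also its square, so this one map
  describes both products inside a factor: \<open>l\<close> times \<open>bar l\<close> cancels, and
  \<open>l\<close> times \<open>l\<close> is \<open>bar l\<close>.\<close>

definition bar :: "bool \<times> int \<Rightarrow> bool \<times> int" where
  "bar l = (fst l, 3 - snd l)"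

text \<open>Group elements are stored as reversed normal forms, so that right multiplication by a letter acts
  on the head of the list.\<close>

fun push :: "(bool \<times> int) list \<Rightarrow> bool \<times> int \<Rightarrow> (bool \<times> int) list" where
  "push [] s = [s]"
| "push (l # v) s = (if fst l \<noteq> fst s then s # l # v else if s = l then bar l # v else v)"

definition alternating :: "(bool \<times> int) list \<Rightarrow> bool" where
  "alternating v \<longleftrightarrow> set v \<subseteq> letters \<and> successively (\<lambda>x y. fst x \<noteq> fst y) v"

lemma finite_letters [simp]: "finite letters"
  by (simp add: letters_def)

lemma letters_cases:
  assumes "l \<in> letters"
  obtains i where "l = (i, 1)" | i where "l = (i, 2)"
  using assms by (auto simp: letters_def)

lemma fst_bar [simp]: "fst (bar l) = fst l"
  by (simp add: bar_def)

lemma bar_bar [simp]: "bar (bar l) = l"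
  by (simp add: bar_def)

lemma bar_in_letters [simp]: "bar l \<in> letters \<longleftrightarrow> l \<in> letters"
  by (cases l) (auto simp: bar_def letters_def)

lemma bar_neq [simp]: "bar l \<noteq> l"
  by (cases l) (simp add: bar_def, presburger)

lemma neq_bar [simp]: "l \<noteq> bar l"
  using bar_neq[of l] by metis

lemma letters_same_factor: "l \<in> letters \<Longrightarrow> t \<in> letters \<Longrightarrow> fst l = fst t \<Longrightarrow> t = l \<or> t = bar l"
  by (cases l; cases t) (auto simp: letters_def bar_def)

lemma sum_letters:
  fixes f :: "bool \<times> int \<Rightarrow> real"
  assumes "l \<in> letters" "t \<in> letters" "fst l \<noteq> fst t"
  shows "(\<Sum>s\<in>letters. f s) = f l + f (bar l) + (f t + f (bar t))"
proof -
  have "s = l \<or> s = bar l \<or> s = t \<or> s = bar t" if "s \<in> letters" for s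
  proof -
    have "fst l = fst s \<or> fst t = fst s" using assms(3) by auto
    then show ?thesis using letters_same_factor assms that by blast
  qed
  then have letters: "letters = {l, bar l, t, bar t}"
    using assms by auto
  have "l \<noteq> bar l" "t \<noteq> bar t" "l \<noteq> t" "l \<noteq> bar t" "bar l \<noteq> t" "bar l \<noteq> bar t"
    using assms(3) bar_neq fst_bar by metis+
  then show ?thesis unfolding letters by (simp add: add.assoc)
qed

lemma alternating_Nil [simp]: "alternating []"
  by (simp add: alternating_def)

lemma alternating_Cons:
  "alternating (l # v) \<longleftrightarrow> l \<in> letters \<and> alternating v \<and> (v = [] \<or> fst (hd v) \<noteq> fst l)"
  by (auto simp: alternating_def successively_Cons)

lemma alternating_rev [simp]: "alternating (rev v) \<longleftrightarrow> alternating v"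
proof -
  have "(\<lambda>x y. fst y \<noteq> fst x) = (\<lambda>x y :: bool \<times> int. fst x \<noteq> fst y)"
    by (auto simp: fun_eq_iff)
  then have "(set v \<subseteq> letters \<and> successively (\<lambda>x y. fst y \<noteq> fst x) v) =
      (set v \<subseteq> letters \<and> successively (\<lambda>x y. fst x \<noteq> fst y) v)"
    by (rule arg_cong[where f = "\<lambda>P. set v \<subseteq> letters \<and> successively P v"])
  then show ?thesis unfolding alternating_def successively_rev set_rev .
qed

lemma alternating_prefix: "alternating w \<Longrightarrow> prefix v w \<Longrightarrow> alternating v"
  by (auto simp: alternating_def prefix_def successively_append_iff)

lemma alternating_push: "alternating v \<Longrightarrow> s \<in> letters \<Longrightarrow> alternating (push v s)"
  by (cases v) (auto simp: alternating_Cons)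

lemma fp_words_eq_alternating: "w \<in> fp_words (\<lambda>_. Z3) \<longleftrightarrow> alternating w"
proof -
  have "fp_letters (\<lambda>_::bool. Z3) = letters"
    by (auto simp: fp_letters_def letters_def carrier_integer_mod_group)
  then show ?thesis by (simp add: fp_words_def alternating_def)
qed

lemma foldr_fp_lmult_append:
  "g @ h \<in> fp_words H \<Longrightarrow> foldr (fp_lmult H) g h = g @ h"
proof (induction g)
  case (Cons x g)
  then have "foldr (fp_lmult H) g h = g @ h" by (simp add: fp_words_Cons)
  with Cons.prems show ?case
    by (cases x; cases "g @ h") (auto simp: fp_words_Cons)
qed simp

text \<open>The group product is built from left multiplications, but only the last letter of a
  normal form can interact with a letter multiplied on the right.\<close>

lemma mult_letter_eq_push:
  assumes "alternating v" "s \<in> letters"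
  shows "foldr (fp_lmult (\<lambda>_. Z3)) (rev v) [s] = rev (push v s)"
proof (cases v)
  case (Cons l v')
  have l: "l \<in> letters" using assms(1) by (simp add: Cons alternating_Cons)
  have "fp_lmult (\<lambda>_. Z3) l [s] = rev (push [l] s)"
  proof (cases "fst l = fst s")
    case True
    with letters_same_factor[OF l assms(2)] have "s = l \<or> s = bar l" by simp
    then show ?thesis
      using l by (auto elim!: letters_cases simp: bar_def mult_integer_mod_group)
  next
    case False
    then show ?thesis by (cases l; cases s) auto
  qed
  moreover have "rev v' @ rev (push [l] s) = rev (push v s)"
    by (auto simp: Cons)
  moreover have "rev (push v s) \<in> fp_words (\<lambda>_. Z3)"
    using alternating_push[OF assms] by (simp add: fp_words_eq_alternating)
  ultimately show ?thesis
    using foldr_fp_lmult_append[of "rev v'" "rev (push [l] s)" "\<lambda>_. Z3"] by (simp add: Cons)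
qed simp


text \<open>Here \<open>wt\<close> is the step distribution and \<open>R = 2 r\<close>; the last assumption is the stationarity equation
  of the multiplicative measure.\<close>

locale z3_weights =
  fixes wt R :: "bool \<times> int \<Rightarrow> real" and \<kappa> \<pi> :: real
  assumes wt_nonneg: "s \<in> letters \<Longrightarrow> 0 \<le> wt s"
    and wt_sum: "s \<in> letters \<Longrightarrow> wt s + wt (bar s) = 1 / 2"
    and wt_prod: "s \<in> letters \<Longrightarrow> wt s * wt (bar s) = \<pi>"
    and R_pos: "s \<in> letters \<Longrightarrow> 0 < R s"
    and R_sum: "s \<in> letters \<Longrightarrow> R s + R (bar s) = 1"
    and kappa_R: "s \<in> letters \<Longrightarrow> wt s + wt (bar s) * R (bar s) = \<kappa> * R s"
begin

text \<open>Add the stationarity equations of \<open>s\<close> and \<open>bar s\<close>. The right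
  side is the mean of \<open>1/2 + wt\<close> under \<open>R\<close>, which therefore is the same in
  both factors.\<close>

lemma kappa:
  assumes s: "s \<in> letters"
  shows "\<kappa> = 1 / 2 + wt s * R s + wt (bar s) * R (bar s)"
proof -
  have "\<kappa> * R s + \<kappa> * R (bar s) = \<kappa>"
    using R_sum[OF s] by (metis distrib_left mult.right_neutral)
  then show ?thesis
    using kappa_R[OF s] kappa_R[of "bar s"] s wt_sum[OF s] by simp
qed

lemma R_less_one: "s \<in> letters \<Longrightarrow> R s < 1"
  using R_pos[of "bar s"] R_sum[of s] by simp

lemma kappa_pos: "0 < \<kappa>"
proof -
  have s: "(True, 1) \<in> letters" "bar (True, 1) \<in> letters" by (simp_all add: letters_def bar_def)
  then have "0 \<le> wt (True, 1) * R (True, 1)" "0 \<le> wt (bar (True, 1)) * R (bar (True, 1))"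
    using wt_nonneg[OF s(1)] wt_nonneg[OF s(2)] R_pos[OF s(1)] R_pos[OF s(2)] by simp_all
  then show ?thesis using kappa[OF s(1)] by linarith
qed

text \<open>Let \<open>\<xi>\<close> be a random infinite alternating word whose letters are drawn in each factor with
  weights \<open>R\<close>, and let \<open>j\<close> be the factor of its first letter. For the group element with reversed
  normal form \<open>v\<close>, \<open>start_prob w j v\<close> is the probability that the infinite word \<open>rev v \<cdot> \<xi>\<close> starts
  with \<open>w\<close>, and \<open>stack_prob w v\<close> is the same probability when no cancellation takes place.\<close>

definition stack_prob :: "(bool \<times> int) list \<Rightarrow> (bool \<times> int) list \<Rightarrow> real" where
  "stack_prob w v =
     (if prefix (rev v) w then prod_list (map R (drop (length v) w))
      else if prefix w (rev v) then 1 else 0)"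

fun start_prob :: "(bool \<times> int) list \<Rightarrow> bool \<Rightarrow> (bool \<times> int) list \<Rightarrow> real" where
  "start_prob w j [] = R (j, 1) * stack_prob w [(j, 1)] + R (j, 2) * stack_prob w [(j, 2)]"
| "start_prob w j (l # v) =
     (if fst l = j then R (bar l) * start_prob w (\<not> j) v + R l * stack_prob w (bar l # v)
      else stack_prob w (l # v))"

text \<open>Each factor holds the first letter of \<open>\<xi>\<close> with probability 1/2. In the
  recursion of \<open>start_prob\<close>, a first letter in the factor of the top letter
  \<open>l\<close> is either \<open>bar l\<close>, which cancels \<open>l\<close> and leaves a
  continuation starting in the other factor, or \<open>l\<close>, which merges with the top letter
  into \<open>bar l\<close>.\<close>

definition cyl_harmonic :: "(bool \<times> int) list \<Rightarrow> (bool \<times> int) list \<Rightarrow> real" where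
  "cyl_harmonic w v = (start_prob w False v + start_prob w True v) / 2"

lemma prod_R_bounds: "set w \<subseteq> letters \<Longrightarrow> 0 \<le> prod_list (map R w) \<and> prod_list (map R w) \<le> 1"
proof (induction w)
  case (Cons s w)
  then show ?case
    using R_pos[of s] R_less_one[of s] by (auto intro!: mult_le_one mult_nonneg_nonneg)
qed simp

lemma stack_prob_bounds: "set w \<subseteq> letters \<Longrightarrow> 0 \<le> stack_prob w v \<and> stack_prob w v \<le> 1"
  using prod_R_bounds[of "drop (length v) w"] set_drop_subset[of "length v" w]
  by (auto simp: stack_prob_def)

lemma stack_prob_eq_of_bool:
  assumes "length w \<le> length v"
  shows "stack_prob w v = of_bool (prefix w (rev v))"
proof (cases "prefix (rev v) w")
  case True
  then have "rev v = w"
    using assms prefix_length_le[OF True] by (auto simp: prefix_def)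
  then show ?thesis by (auto simp: stack_prob_def)
qed (auto simp: stack_prob_def)

lemma stack_prob_long:
  assumes "length w \<le> length v"
  shows "stack_prob w (l # v) = stack_prob w v"
proof -
  have "prefix w (rev v @ [l]) \<longleftrightarrow> prefix w (rev v)"
    using assms by (auto dest: prefix_length_le)
  then show ?thesis
    using assms stack_prob_eq_of_bool[of w v] stack_prob_eq_of_bool[of w "l # v"] by simp
qed

lemma stack_prob_branch:
  assumes "alternating w" "v \<noteq> []" "t \<in> letters" "fst (hd v) \<noteq> fst t"
  shows "stack_prob w v = R t * stack_prob w (t # v) + R (bar t) * stack_prob w (bar t # v)"
proof (cases "length w \<le> length v")
  case True
  have "R t * x + R (bar t) * x = x" for x
    using R_sum[OF assms(3)] by (metis distrib_right mult_1)
  with True show ?thesis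
    by (simp add: stack_prob_long)
next
  case long: False
  have np: "\<not> prefix w (rev v)" "\<not> prefix w (rev v @ [s]) \<or> w = rev v @ [s]" for s
    using long by (auto dest: prefix_length_le)
  show ?thesis
  proof (cases "prefix (rev v) w")
    case False
    then have "\<not> prefix (rev v @ [s]) w" for s by (auto simp: prefix_def)
    with False np show ?thesis by (auto simp: stack_prob_def)
  next
    case True
    then obtain z where z: "w = rev v @ z" by (rule prefixE)
    with long obtain u w' where w: "w = rev v @ u # w'" by (cases z) auto
    obtain l v' where v: "v = l # v'" using assms(2) by (cases v) auto
    have u: "u \<in> letters" "fst u \<noteq> fst (hd v)"
      using assms(1) by (auto simp: w v alternating_def successively_append_iff successively_Cons)
    then have "fst u = fst t" using assms(4) by auto
    then have ut: "u = t \<or> u = bar t"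
      using letters_same_factor[of t u] assms(3) u by auto
    have "stack_prob w (s # v) = (if s = u then prod_list (map R w') else 0)" for s
      by (auto simp: w stack_prob_def)
    moreover have "stack_prob w v = R u * prod_list (map R w')"
      by (simp add: w stack_prob_def)
    ultimately show ?thesis using ut by auto
  qed
qed

text \<open>Neither an empty stack nor a top letter in the other factor allows a cancellation, so
  the first letter of \<open>\<xi>\<close> is simply pushed.\<close>

lemma start_prob_branch:
  assumes "alternating w" "v = [] \<or> fst (hd v) \<noteq> fst t" "t \<in> letters"
  shows "start_prob w (fst t) v = R t * stack_prob w (t # v) + R (bar t) * stack_prob w (bar t # v)"
proof (cases v)
  case Nil
  have "t = (fst t, 1) \<and> bar t = (fst t, 2) \<or> bar t = (fst t, 1) \<and> t = (fst t, 2)"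
    using assms(3) by (cases t) (auto simp: letters_def bar_def)
  then show ?thesis unfolding Nil start_prob.simps by (metis add.commute)
next
  case (Cons l v')
  then show ?thesis
    using stack_prob_branch[of w v t] assms by auto
qed

lemma convex_unit_interval:
  fixes x y u v :: real
  assumes "0 \<le> x \<and> x \<le> 1" "0 \<le> y \<and> y \<le> 1" "0 < u" "0 < v" "u + v = 1"
  shows "0 \<le> u * x + v * y \<and> u * x + v * y \<le> 1"
  using assms convex_bound_le[of x 1 y u v] by (auto intro!: add_nonneg_nonneg mult_nonneg_nonneg)

lemma start_prob_bounds:
  assumes w: "alternating w" and "alternating v"
  shows "0 \<le> start_prob w j v \<and> start_prob w j v \<le> 1"
  using assms(2)
proof (induction v arbitrary: j)
  case Nil
  have t: "(j, 1) \<in> letters" "bar (j, 1) \<in> letters" "bar (j, 1) = (j, 2)"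
    by (auto simp: letters_def bar_def)
  show ?case
    unfolding start_prob.simps using w
    by (intro convex_unit_interval stack_prob_bounds)
      (use R_pos[OF t(1)] R_pos[OF t(2)] R_sum[OF t(1)] t(3) in \<open>auto simp: alternating_def\<close>)
next
  case (Cons l v)
  have l: "l \<in> letters" "bar l \<in> letters" "alternating v" using Cons.prems by (auto simp: alternating_Cons)
  have s: "set w \<subseteq> letters" using w by (simp add: alternating_def)
  have "0 \<le> R (bar l) * start_prob w (\<not> j) v + R l * stack_prob w (bar l # v) \<and>
      R (bar l) * start_prob w (\<not> j) v + R l * stack_prob w (bar l # v) \<le> 1"
    by (intro convex_unit_interval stack_prob_bounds[OF s] Cons.IH[OF l(3)])
      (use R_pos[OF l(1)] R_pos[OF l(2)] R_sum[OF l(1)] in auto)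
  then show ?case using stack_prob_bounds[OF s] by simp
qed

text \<open>The algebraic core of harmonicity. \<open>A\<close> is the start probability in the
  factor of the top letter, \<open>B1\<close> the one in the other factor; \<open>m\<close>,
  \<open>S\<close> are the weights in the top factor and \<open>n\<close>, \<open>T\<close> those in
  the other. Steps in the other factor contribute \<open>k * B1 + (1 - k) * A\<close>, steps in the
  top factor the same with \<open>A\<close> and \<open>B1\<close> exchanged.\<close>

lemma harmonic_identity:
  assumes k: "m1 + m2 * S2 = k * S1" "m2 + m1 * S1 = k * S2" and S: "S1 + S2 = 1" and m: "m1 + m2 = (1 / 2 :: real)"
    and k': "n1 + n2 * T2 = k * T1" "n2 + n1 * T1 = k * T2" and T: "T1 + T2 = 1" and n: "n1 + n2 = 1 / 2"
    and B1: "B1 = T1 * b1 + T2 * b2" and A: "A = S2 * Q + S1 * B2"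
  shows "n1 * (b1 + (T2 * A + T1 * b2)) + n2 * (b2 + (T1 * A + T2 * b1))
      + (m1 * (B2 + (S1 * Q + S2 * B1)) + m2 * (Q + (S1 * B1 + S2 * B2))) = B1 + A"
proof -
  have S2: "S2 = 1 - S1" and T2: "T2 = 1 - T1" and m2: "m2 = 1 / 2 - m1" and n2: "n2 = 1 / 2 - n1"
    using S T m n by auto
  have "k * S1 + k * S2 = k" "k * T1 + k * T2 = k" using S T by (metis distrib_left mult.right_neutral)+
  then have K1: "k = 1 / 2 + m1 * S1 + m2 * S2" and K2: "k = 1 / 2 + n1 * T1 + n2 * T2"
    using k k' m n by linarith+
  have "n1 * (b1 + (T2 * A + T1 * b2)) + n2 * (b2 + (T1 * A + T2 * b1)) =
     (n1 + n2 * T2) * b1 + (n2 + n1 * T1) * b2 + (n1 * T2 + n2 * T1) * A"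
    by (simp add: algebra_simps)
  also have "\<dots> = k * B1 + (n1 * T2 + n2 * T1) * A"
    unfolding k' B1 by (simp add: algebra_simps)
  also have "n1 * T2 + n2 * T1 = 1 - k"
    unfolding K2 T2 n2 by (simp add: field_simps)
  finally have 1: "n1 * (b1 + (T2 * A + T1 * b2)) + n2 * (b2 + (T1 * A + T2 * b1)) = k * B1 + (1 - k) * A" .
  have "m1 * (B2 + (S1 * Q + S2 * B1)) + m2 * (Q + (S1 * B1 + S2 * B2)) =
    (m1 + m2 * S2) * B2 + (m2 + m1 * S1) * Q + (m1 * S2 + m2 * S1) * B1"
    by (simp add: algebra_simps)
  also have "\<dots> = k * A + (m1 * S2 + m2 * S1) * B1"
    unfolding k A by (simp add: algebra_simps)
  also have "m1 * S2 + m2 * S1 = 1 - k"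
    unfolding K1 S2 m2 by (simp add: field_simps)
  finally show ?thesis using 1 by (simp add: algebra_simps)
qed

lemma start_prob_False_True:
  "start_prob w False v + start_prob w True v = start_prob w i v + start_prob w (\<not> i) v"
  by (cases i) auto

lemma cyl_harmonic_push_other:
  "cyl_harmonic w (t # v) = (stack_prob w (t # v) +
    (R (bar t) * start_prob w (\<not> fst t) v + R t * stack_prob w (bar t # v))) / 2"
  by (simp add: cyl_harmonic_def start_prob_False_True[of w _ "fst t"])

lemma cyl_harmonic_mean:
  assumes w: "alternating w" and v: "alternating v"
  shows "(\<Sum>s\<in>letters. wt s * cyl_harmonic w (push v s)) = cyl_harmonic w v"
proof (cases v)
  case Nil
  \<comment> \<open>At the identity, the steps in one factor give weight \<open>\<kappa>\<close> to
    a start in that factor and \<open>1 - \<kappa>\<close> to a start in the other, so over both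
    factors the coefficients add up to 1.\<close>
  have pair: "wt t * cyl_harmonic w [t] + wt (bar t) * cyl_harmonic w [bar t]
      = (\<kappa> * start_prob w (fst t) [] + (1 - \<kappa>) * start_prob w (\<not> fst t) []) / 2"
    if t: "t \<in> letters" for t
  proof -
    let ?b1 = "stack_prob w [t]" and ?b2 = "stack_prob w [bar t]" and ?A = "start_prob w (\<not> fst t) []"
    have h: "cyl_harmonic w [t] = (?b1 + (R (bar t) * ?A + R t * ?b2)) / 2"
      "cyl_harmonic w [bar t] = (?b2 + (R t * ?A + R (bar t) * ?b1)) / 2"
      using cyl_harmonic_push_other[of w t "[]"] cyl_harmonic_push_other[of w "bar t" "[]"]
      by (simp_all only: fst_bar bar_bar)
    have "wt t * cyl_harmonic w [t] + wt (bar t) * cyl_harmonic w [bar t] =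
       ((wt t + wt (bar t) * R (bar t)) * ?b1 + (wt (bar t) + wt t * R t) * ?b2
         + (wt t * R (bar t) + wt (bar t) * R t) * ?A) / 2"
      unfolding h by (simp add: field_simps del: start_prob.simps)
    also have "wt t + wt (bar t) * R (bar t) = \<kappa> * R t" using kappa_R[OF t] .
    also have "wt (bar t) + wt t * R t = \<kappa> * R (bar t)" using kappa_R[of "bar t"] t by simp
    also have "wt t * R (bar t) + wt (bar t) * R t = 1 - \<kappa>"
    proof -
      have "R (bar t) = 1 - R t" "wt (bar t) = 1 / 2 - wt t" using R_sum[OF t] wt_sum[OF t] by auto
      note eqs = this
      show ?thesis unfolding kappa[OF t] eqs by (simp add: field_simps)
    qed
    also have "\<kappa> * R t * ?b1 + \<kappa> * R (bar t) * ?b2 = \<kappa> * start_prob w (fst t) []"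
      using start_prob_branch[OF w _ t, of "[]"] by (simp add: algebra_simps del: start_prob.simps)
    finally show ?thesis .
  qed
  have t: "(False, 1) \<in> letters" "(True, 1) \<in> letters" "fst (False, 1::int) \<noteq> fst (True, 1::int)"
    by (auto simp: letters_def)
  show ?thesis
    using pair[OF t(1)] pair[OF t(2)]
    by (simp add: Nil sum_letters[OF t] cyl_harmonic_def[of w "[]"] field_simps del: start_prob.simps)
next
  case (Cons l v')
  define t where "t = (\<not> fst l, 1::int)"
  have l: "l \<in> letters" and v': "alternating v'" "v' = [] \<or> fst (hd v') \<noteq> fst l"
    using v by (auto simp: Cons alternating_Cons)
  have t: "t \<in> letters" "fst l \<noteq> fst t" by (auto simp: t_def letters_def)
  have ft: "(\<not> fst t) = fst l" by (simp add: t_def)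
  let ?A = "start_prob w (fst l) (l # v')" and ?Q = "start_prob w (\<not> fst l) v'"
  let ?B1 = "stack_prob w (l # v')" and ?B2 = "stack_prob w (bar l # v')"
  let ?b1 = "stack_prob w (t # l # v')" and ?b2 = "stack_prob w (bar t # l # v')"
  have h_t: "cyl_harmonic w (push v t) = (?b1 + (R (bar t) * ?A + R t * ?b2)) / 2"
    "cyl_harmonic w (push v (bar t)) = (?b2 + (R t * ?A + R (bar t) * ?b1)) / 2"
    using cyl_harmonic_push_other[of w t "l # v'"] cyl_harmonic_push_other[of w "bar t" "l # v'"] t(2) ft
    by (simp_all add: Cons del: start_prob.simps)
  have h_same: "cyl_harmonic w (push v l) = (?B2 + (R l * ?Q + R (bar l) * ?B1)) / 2"
    using cyl_harmonic_push_other[of w "bar l" v'] by (simp add: Cons del: start_prob.simps)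
  \<comment> \<open>This step removes \<open>l\<close>. The start at \<open>v'\<close> in the factor
    of \<open>l\<close> is the \<open>R\<close>-mean of \<open>?B1\<close> and \<open>?B2\<close>,
    which expresses all four steps in common terms.\<close>
  have h_pop: "cyl_harmonic w (push v (bar l)) = (?Q + (R l * ?B1 + R (bar l) * ?B2)) / 2"
    using start_prob_branch[OF w v'(2) l] bar_neq[of l]
    by (simp add: Cons cyl_harmonic_def start_prob_False_True[of w v' "fst l"] del: start_prob.simps)
  have h_v: "cyl_harmonic w v = (?B1 + ?A) / 2"
    by (simp add: Cons cyl_harmonic_def start_prob_False_True[of w "l # v'" "fst l"])
  have B1: "?B1 = R t * ?b1 + R (bar t) * ?b2"
    by (rule stack_prob_branch) (use w t in auto)
  have "wt t * (?b1 + (R (bar t) * ?A + R t * ?b2)) + wt (bar t) * (?b2 + (R t * ?A + R (bar t) * ?b1))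
      + (wt l * (?B2 + (R l * ?Q + R (bar l) * ?B1)) + wt (bar l) * (?Q + (R l * ?B1 + R (bar l) * ?B2))) = ?B1 + ?A"
  proof (rule harmonic_identity[where k = \<kappa>])
    show "wt (bar l) + wt l * R l = \<kappa> * R (bar l)" "wt (bar t) + wt t * R t = \<kappa> * R (bar t)"
      using kappa_R[of "bar l"] kappa_R[of "bar t"] l t by auto
  qed (use kappa_R[OF l] kappa_R[OF t(1)] l t(1) R_sum wt_sum B1 in auto)
  then show ?thesis
    unfolding sum_letters[OF l t] h_t h_same h_pop h_v by (simp add: field_simps del: start_prob.simps)
qed

definition rho :: real where
  "rho = Max (R ` letters)"

lemma rho_bounds: "0 < rho" "rho < 1"
proof -
  have ne: "letters \<noteq> {}" by (auto simp: letters_def)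
  have "rho \<in> R ` letters" unfolding rho_def using ne by (intro Max_in) auto
  then show "0 < rho" "rho < 1" using R_pos R_less_one by auto
qed

lemma R_le_rho: "s \<in> letters \<Longrightarrow> R s \<le> rho"
  by (simp add: rho_def)

text \<open>To disturb the first \<open>length w\<close> letters, \<open>\<xi>\<close> has to cancel
  every letter above them, and each cancellation costs a factor of at most
  \<open>rho\<close>.\<close>

lemma start_prob_approx:
  assumes w: "alternating w" and "alternating v" "length w \<le> length v"
  shows "\<bar>start_prob w j v - of_bool (prefix w (rev v))\<bar> \<le> rho ^ (length v - length w)"
  using assms(2,3)
proof (induction v arbitrary: j)
  case Nil
  then show ?case using start_prob_bounds[OF w, of "[]" j] by (auto simp del: start_prob.simps)
next
  case (Cons l v)
  have l: "l \<in> letters" "alternating v" using Cons.prems by (auto simp: alternating_Cons)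
  show ?case
  proof (cases "length w \<le> length v")
    \<comment> \<open>Here \<open>l\<close> sits exactly at depth \<open>length w\<close>; the
      exponent is 0 and the bound is trivial.\<close>
    case False
    then have "length (l # v) - length w = 0" by simp
    then show ?thesis using start_prob_bounds[OF w Cons.prems(1), of j]
      by (auto simp del: start_prob.simps)
  next
    case True
    let ?d = "of_bool (prefix w (rev v)) :: real"
    have d: "of_bool (prefix w (rev (l # v))) = ?d" "stack_prob w (bar l # v) = ?d" "stack_prob w (l # v) = ?d"
      using stack_prob_long[OF True] stack_prob_eq_of_bool[OF True] stack_prob_eq_of_bool[of w "l # v"] True
      by (auto simp del: of_bool_eq_iff)
    show ?thesis
    proof (cases "fst l = j")
      case False
      then show ?thesis using d rho_bounds(1) by (simp add: less_imp_le)
    next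
      case j: True
      have Rl: "R l = 1 - R (bar l)" using R_sum[OF l(1)] by simp
      have "start_prob w j (l # v) - ?d = R (bar l) * (start_prob w (\<not> j) v - ?d)"
        using j d(2) unfolding start_prob.simps Rl by (simp add: algebra_simps)
      then have "\<bar>start_prob w j (l # v) - ?d\<bar> = R (bar l) * \<bar>start_prob w (\<not> j) v - ?d\<bar>"
        using R_pos[of "bar l"] l by (simp add: abs_mult del: start_prob.simps)
      also have "\<dots> \<le> rho * rho ^ (length v - length w)"
        using Cons.IH[OF l(2) True] rho_bounds R_le_rho[of "bar l"] l
        by (intro mult_mono) auto
      also have "\<dots> = rho ^ (length (l # v) - length w)"
        using True by (simp add: Suc_diff_le)
      finally show ?thesis unfolding d(1) .
    qed
  qed
qed

lemma cyl_harmonic_approx: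
  assumes "alternating w" "alternating v" "length w \<le> length v"
  shows "\<bar>cyl_harmonic w v - of_bool (prefix w (rev v))\<bar> \<le> rho ^ (length v - length w)"
  using start_prob_approx[OF assms, of False] start_prob_approx[OF assms, of True]
  unfolding cyl_harmonic_def by (simp add: abs_le_iff field_simps del: start_prob.simps)

lemma cyl_harmonic_bounds:
  assumes "alternating w" "alternating v"
  shows "\<bar>cyl_harmonic w v\<bar> \<le> 1"
  using start_prob_bounds[OF assms, of False] start_prob_bounds[OF assms, of True]
  by (auto simp: cyl_harmonic_def)

lemma cyl_harmonic_Nil:
  assumes "alternating w" "w \<noteq> []"
  shows "cyl_harmonic w [] = prod_list (map R w) / 2"
proof -
  obtain s w' where w: "w = s # w'" using assms(2) by (cases w) auto
  have s: "s \<in> letters" using assms(1) by (simp add: w alternating_Cons)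
  have "stack_prob w [t] = (if t = s then prod_list (map R w') else 0)" for t
    by (auto simp: stack_prob_def w)
  then have "start_prob w j [] = (if fst s = j then R s * prod_list (map R w') else 0)" for j
    using s by (auto elim!: letters_cases)
  then show ?thesis
    by (cases "fst s") (simp_all add: cyl_harmonic_def w del: start_prob.simps)
qed

end

section \<open>Lengths of converging words, and histories of random letters\<close>

lemma sum_list_map_bounds:
  fixes c :: "'l \<Rightarrow> real"
  assumes "\<And>s. s \<in> set w \<Longrightarrow> c0 \<le> c s \<and> c s \<le> C"
  shows "c0 * real (length w) \<le> sum_list (map c w) \<and> sum_list (map c w) \<le> C * real (length w)"
  using assms
proof (induction w)
  case (Cons s w)
  then have "c0 \<le> c s \<and> c s \<le> C"
    "c0 * real (length w) \<le> sum_list (map c w) \<and> sum_list (map c w) \<le> C * real (length w)" by auto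
  then show ?case by (auto simp: algebra_simps)
qed simp

lemma filterlim_length_at_top:
  fixes c :: "'l \<Rightarrow> real"
  assumes c: "\<And>n s. s \<in> set (g n) \<Longrightarrow> c s \<le> C" and "0 < D"
    and big: "\<forall>\<^sub>F n in sequentially. D * real n \<le> sum_list (map c (g n))"
  shows "filterlim (\<lambda>n. length (g n)) at_top sequentially"
proof -
  have "filterlim (\<lambda>n. D * real n) at_top sequentially"
    using \<open>0 < D\<close> by (intro filterlim_tendsto_pos_mult_at_top[OF tendsto_const]) (auto intro: filterlim_real_sequentially)
  then have *: "filterlim (\<lambda>n. \<bar>C\<bar> * real (length (g n))) at_top sequentially"
  proof (rule filterlim_at_top_mono)
    show "\<forall>\<^sub>F n in sequentially. D * real n \<le> \<bar>C\<bar> * real (length (g n))"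
      using big
    proof eventually_elim
      case (elim n)
      have "sum_list (map c (g n)) \<le> sum_list (map (\<lambda>_. \<bar>C\<bar>) (g n))"
        using c[of _ n] by (intro sum_list_mono) fastforce
      with elim show ?case by (simp add: sum_list_triv mult.commute)
    qed
  qed
  show ?thesis
    unfolding filterlim_at_top
  proof
    fix Z :: nat
    have "\<forall>\<^sub>F n in sequentially. \<bar>C\<bar> * real Z + 1 \<le> \<bar>C\<bar> * real (length (g n))"
      using * unfolding filterlim_at_top by blast
    then show "\<forall>\<^sub>F n in sequentially. Z \<le> length (g n)"
    proof eventually_elim
      case (elim n)
      show ?case
      proof (rule ccontr)
        assume "\<not> Z \<le> length (g n)"
        then have "\<bar>C\<bar> * real (length (g n)) \<le> \<bar>C\<bar> * real Z" by (intro mult_left_mono) auto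
        with elim show False by linarith
      qed
    qed
  qed
qed

text \<open>A step can touch only the last letter, so the first \<open>k\<close> letters survive as
  long as the length stays strictly above \<open>k\<close>.\<close>

lemma take_stable:
  assumes step: "\<And>n. take (length (g n) - 1) (g (Suc n)) = take (length (g n) - 1) (g n)"
    and long: "\<And>m. n \<le> m \<Longrightarrow> k < length (g m)" and "n \<le> m"
  shows "take k (g m) = take k (g n)"
  using \<open>n \<le> m\<close>
proof (induction m rule: dec_induct)
  case (step m)
  have "k < length (g m)" using long step.hyps by simp
  then have "take k (g (Suc m)) = take k (g m)"
    using assms(1)[of m] by (metis Suc_diff_1 Suc_leI length_greater_0_conv less_Suc_eq_le list.size(3) min.absorb1 not_less_zero take_take)
  then show ?case using step.IH by simp
qed simp

text \<open>The letters of \<open>g n\<close> below the future minimum of the lengths are final. They carry almost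
  all the \<open>c\<close>-weight of \<open>g n\<close>, because this weight grows linearly.\<close>

lemma length_div_tendsto:
  fixes g :: "nat \<Rightarrow> 'l list" and c :: "'l \<Rightarrow> real"
  assumes c: "\<And>n s. s \<in> set (g n) \<Longrightarrow> c0 \<le> c s \<and> c s \<le> C" and "0 < c0" "0 < D" "0 < \<kappa>"
    and D: "(\<lambda>n. sum_list (map c (g n)) / real n) \<longlonglongrightarrow> D"
    and step: "\<And>n. take (length (g n) - 1) (g (Suc n)) = take (length (g n) - 1) (g n)"
    and lim: "\<And>k. \<forall>\<^sub>F n in sequentially. take k (g n) = stake k \<xi>"
    and \<kappa>: "(\<lambda>k. sum_list (map c (stake k \<xi>)) / real k) \<longlonglongrightarrow> \<kappa>"
  shows "(\<lambda>n. real (length (g n)) / real n) \<longlonglongrightarrow> D / \<kappa>"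
proof -
  define \<phi> where "\<phi> w = sum_list (map c w)" for w
  define N where "N n = Inf ((\<lambda>m. length (g m)) ` {n..})" for n
  \<comment> \<open>One less than the future minimum, because at a time where the minimum is
    attained the last letter may still be replaced.\<close>
  define K where "K n = N n - 1" for n
  define a where "a n = \<phi> (stake (K n) \<xi>)" for n
  have "\<exists>m\<ge>n. length (g m) = N n" for n
    using Inf_nat_def1[of "(\<lambda>m. length (g m)) ` {n..}"] unfolding N_def by force
  then obtain \<mu> where \<mu>: "\<And>n. n \<le> \<mu> n" "\<And>n. length (g (\<mu> n)) = N n" by metis
  have N_le: "N n \<le> length (g m)" if "n \<le> m" for n m
    unfolding N_def using that by (intro cInf_lower) auto
  have \<phi>_split: "\<phi> w = \<phi> (take k w) + \<phi> (drop k w)" for k w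
    unfolding \<phi>_def by (metis append_take_drop_id map_append sum_list_append)
  have \<phi>_drop: "c0 * real (length (g n) - k) \<le> \<phi> (drop k (g n)) \<and> \<phi> (drop k (g n)) \<le> C * real (length (g n) - k)" for k n
    using sum_list_map_bounds[of "drop k (g n)" c0 c C] c in_set_dropD unfolding \<phi>_def by (metis length_drop)
  have C: "0 \<le> C" if "g n \<noteq> []" for n
    using c[of "hd (g n)" n] that \<open>0 < c0\<close> by auto
  have stable: "take (K n) (g m) = stake (K n) \<xi>" if "n \<le> m" for n m
  proof (cases "N n = 0")
    case False
    then have long: "K n < length (g m')" if "n \<le> m'" for m' using N_le[OF that] by (simp add: K_def)
    obtain M where M: "\<And>m. M \<le> m \<Longrightarrow> take (K n) (g m) = stake (K n) \<xi>"
      using lim[of "K n"] by (auto simp: eventually_sequentially)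
    show ?thesis
      using take_stable[of g n "K n" m, OF step long that] take_stable[of g n "K n" "max n M", OF step long] M[of "max n M"]
      by simp
  qed (simp add: K_def)
  \<comment> \<open>Each letter beyond the final prefix weighs at least \<open>c0\<close>, so the
    surplus length is controlled by the surplus weight, which turns out to be
    \<open>o(n)\<close>.\<close>
  have upper: "a n \<le> \<phi> (g n)" and len: "real (length (g n)) \<le> real (K n) + (\<phi> (g n) - a n) / c0" for n
  proof -
    have s: "\<phi> (g n) = a n + \<phi> (drop (K n) (g n))"
      using \<phi>_split[of "g n" "K n"] stable[of n n] by (simp add: a_def)
    have p: "0 \<le> c0 * real (length (g n) - K n)" using \<open>0 < c0\<close> by simp
    show "a n \<le> \<phi> (g n)" using s p \<phi>_drop[of n "K n"] by linarith
    have "K n \<le> length (g n)" using N_le[of n n] by (simp add: K_def)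
    then have "c0 * (real (length (g n)) - real (K n)) \<le> \<phi> (g n) - a n"
      using s \<phi>_drop[of n "K n"] by (simp add: of_nat_diff)
    then show "real (length (g n)) \<le> real (K n) + (\<phi> (g n) - a n) / c0"
      using \<open>0 < c0\<close> by (simp add: field_simps)
  qed
  \<comment> \<open>At the time \<open>\<mu> n\<close> of the future minimum, at most one letter
    lies beyond the final prefix.\<close>
  have lower: "\<phi> (g (\<mu> n)) - \<bar>C\<bar> \<le> a n" for n
  proof -
    have "\<phi> (g (\<mu> n)) = a n + \<phi> (drop (K n) (g (\<mu> n)))"
      using \<phi>_split[of "g (\<mu> n)" "K n"] stable[of n "\<mu> n"] \<mu>(1) by (simp add: a_def)
    moreover have "\<phi> (drop (K n) (g (\<mu> n))) \<le> \<bar>C\<bar>"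
    proof -
      have "length (g (\<mu> n)) - K n \<le> 1" by (simp add: \<mu>(2) K_def)
      then have "C * real (length (g (\<mu> n)) - K n) \<le> \<bar>C\<bar> * 1"
        by (intro mult_mono) auto
      then show ?thesis using \<phi>_drop[of "\<mu> n" "K n"] by linarith
    qed
    ultimately show ?thesis by linarith
  qed
  have \<mu>_lim: "filterlim \<mu> at_top sequentially"
    using \<mu>(1) by (intro filterlim_at_top_mono[OF filterlim_ident]) auto
  \<comment> \<open>From below, the weight at time \<open>\<mu> n\<close> is about
    \<open>D * \<mu> n\<close>, and \<open>n \<le> \<mu> n\<close>.\<close>
  have aD: "(\<lambda>n. a n / real n) \<longlonglongrightarrow> D"
  proof (rule tendsto_sandwich[OF _ _ _ D])
    show "(\<lambda>n. \<phi> (g (\<mu> n)) / real (\<mu> n) - \<bar>C\<bar> / real n) \<longlonglongrightarrow> D"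
      using tendsto_diff[OF filterlim_compose[OF D \<mu>_lim] lim_const_over_n[of "\<bar>C\<bar>"]] by (simp add: \<phi>_def)
    show "\<forall>\<^sub>F n in sequentially. a n / real n \<le> sum_list (map c (g n)) / real n"
      using upper by (auto simp: \<phi>_def divide_right_mono)
    show "\<forall>\<^sub>F n in sequentially. \<phi> (g (\<mu> n)) / real (\<mu> n) - \<bar>C\<bar> / real n \<le> a n / real n"
    proof (rule eventually_sequentiallyI)
      fix n :: nat assume n: "1 \<le> n"
      have "0 \<le> \<phi> (g (\<mu> n))"
      proof -
        have "0 \<le> c0 * real (length (g (\<mu> n)) - 0)" using \<open>0 < c0\<close> by simp
        then show ?thesis using \<phi>_drop[of "\<mu> n" 0] by simp
      qed
      then have "\<phi> (g (\<mu> n)) / real (\<mu> n) \<le> \<phi> (g (\<mu> n)) / real n"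
        using n \<mu>(1)[of n] by (intro divide_left_mono) auto
      also have "\<dots> - \<bar>C\<bar> / real n \<le> a n / real n"
        using lower[of n] by (metis diff_divide_distrib divide_right_mono of_nat_0_le_iff)
      finally show "\<phi> (g (\<mu> n)) / real (\<mu> n) - \<bar>C\<bar> / real n \<le> a n / real n" by simp
    qed
  qed
  have len_top: "filterlim (\<lambda>n. length (g n)) at_top sequentially"
  proof (rule filterlim_length_at_top)
    show "c s \<le> C" if "s \<in> set (g n)" for n s using c that by blast
    show "0 < D / 2" using \<open>0 < D\<close> by simp
    have "\<forall>\<^sub>F n in sequentially. D / 2 < sum_list (map c (g n)) / real n"
      using D \<open>0 < D\<close> by (intro order_tendstoD) auto
    then show "\<forall>\<^sub>F n in sequentially. D / 2 * real n \<le> sum_list (map c (g n))"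
      using eventually_gt_at_top[of 0] by eventually_elim (simp add: field_simps)
  qed
  have K_lim: "filterlim K at_top sequentially"
    unfolding filterlim_at_top
  proof
    fix Z :: nat
    obtain n0 where n0: "\<And>n. n0 \<le> n \<Longrightarrow> Suc Z \<le> length (g n)"
      using len_top unfolding filterlim_at_top eventually_sequentially by blast
    show "\<forall>\<^sub>F n in sequentially. Z \<le> K n"
    proof (rule eventually_sequentiallyI)
      fix n assume "n0 \<le> n"
      then have "Suc Z \<le> N n" using n0[of "\<mu> n"] \<mu>[of n] by simp
      then show "Z \<le> K n" by (simp add: K_def)
    qed
  qed
  have "(\<lambda>n. a n / real (K n)) \<longlonglongrightarrow> \<kappa>"
    using filterlim_compose[OF \<kappa> K_lim] by (simp add: a_def \<phi>_def)
  \<comment> \<open>The final prefix weighs about \<open>D * n\<close> and also about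
    \<open>\<kappa> * K n\<close>; comparing the two gives the growth of \<open>K\<close>.\<close>
  then have "(\<lambda>n. (a n / real n) / (a n / real (K n))) \<longlonglongrightarrow> D / \<kappa>"
    using \<open>0 < \<kappa>\<close> by (intro tendsto_divide aD) auto
  moreover have "\<forall>\<^sub>F n in sequentially. (a n / real n) / (a n / real (K n)) = real (K n) / real n"
  proof -
    have "\<forall>\<^sub>F n in sequentially. 0 < a n / real n" using aD \<open>0 < D\<close> by (rule order_tendstoD)
    then show ?thesis by eventually_elim auto
  qed
  ultimately have Kn: "(\<lambda>n. real (K n) / real n) \<longlonglongrightarrow> D / \<kappa>"
    by (rule Lim_transform_eventually)
  show ?thesis
  proof (rule tendsto_sandwich[OF _ _ Kn])
    show "\<forall>\<^sub>F n in sequentially. real (K n) / real n \<le> real (length (g n)) / real n"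
      using N_le by (intro always_eventually allI divide_right_mono) (auto simp: K_def intro: le_trans[OF diff_le_self])
    show "\<forall>\<^sub>F n in sequentially. real (length (g n)) / real n \<le>
        real (K n) / real n + (\<phi> (g n) / real n - a n / real n) / c0"
    proof (intro always_eventually allI)
      fix n
      have "real (length (g n)) / real n \<le> (real (K n) + (\<phi> (g n) - a n) / c0) / real n"
        using len by (intro divide_right_mono) auto
      then show "real (length (g n)) / real n \<le> real (K n) / real n + (\<phi> (g n) / real n - a n / real n) / c0"
        by (simp add: add_divide_distrib diff_divide_distrib mult.commute)
    qed
    have "(\<lambda>n. real (K n) / real n + (\<phi> (g n) / real n - a n / real n) / c0) \<longlonglongrightarrow> D / \<kappa> + (D - D) / c0"
      using D \<open>0 < c0\<close> by (intro tendsto_intros Kn aD) (auto simp: \<phi>_def)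
    then show "(\<lambda>n. real (K n) / real n + (\<phi> (g n) / real n - a n / real n) / c0) \<longlonglongrightarrow> D / \<kappa>" by simp
  qed
qed


section \<open>Martingale arguments on finite histories\<close>

definition history :: "(nat \<Rightarrow> 'w \<Rightarrow> 's) \<Rightarrow> nat \<Rightarrow> 'w \<Rightarrow> 's list" where
  "history z n \<omega> = map (\<lambda>i. z i \<omega>) [0..<n]"

lemma history_0 [simp]: "history z 0 \<omega> = []"
  and history_Suc: "history z (Suc n) \<omega> = history z n \<omega> @ [z n \<omega>]"
  and length_history [simp]: "length (history z n \<omega>) = n"
  and take_history: "m \<le> n \<Longrightarrow> take m (history z n \<omega>) = history z m \<omega>"
  by (auto simp: history_def take_map)

lemma measurable_history [measurable]:
  fixes z :: "nat \<Rightarrow> 'w \<Rightarrow> 's :: countable"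
  assumes [measurable]: "\<And>n. z n \<in> M \<rightarrow>\<^sub>M count_space UNIV"
  shows "history z n \<in> M \<rightarrow>\<^sub>M count_space UNIV"
proof (induction n)
  case (Suc n)
  note [measurable] = Suc
  have "(\<lambda>\<omega>. history z n \<omega> @ [z n \<omega>]) \<in> M \<rightarrow>\<^sub>M count_space UNIV"
    by measurable
  then show ?case by (simp add: history_Suc[abs_def])
qed (simp add: history_def)

lemma sum_lists_length_Suc:
  fixes F :: "'s list \<Rightarrow> real"
  shows "(\<Sum>y | set y \<subseteq> S \<and> length y = Suc n. F y) = (\<Sum>y | set y \<subseteq> S \<and> length y = n. \<Sum>s\<in>S. F (y @ [s]))"
proof -
  have "(\<Sum>y | set y \<subseteq> S \<and> length y = n. \<Sum>s\<in>S. F (y @ [s])) =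
      (\<Sum>(y, s)\<in>{y. set y \<subseteq> S \<and> length y = n} \<times> S. F (y @ [s]))"
    by (rule sum.cartesian_product)
  also have "\<dots> = (\<Sum>y | set y \<subseteq> S \<and> length y = Suc n. F y)"
  proof (rule sum.reindex_bij_witness[where j = "\<lambda>(y, s). y @ [s]" and i = "\<lambda>y. (butlast y, last y)"])
    fix y assume y: "y \<in> {y. set y \<subseteq> S \<and> length y = Suc n}"
    then have ne: "y \<noteq> []" by auto
    show "(\<lambda>(y, s). y @ [s]) (butlast y, last y) = y" using ne by simp
    show "(butlast y, last y) \<in> {y. set y \<subseteq> S \<and> length y = n} \<times> S"
      using y ne last_in_set[OF ne] by (auto dest: in_set_butlastD)
  qed auto
  finally show ?thesis by simp
qed

context prob_space
begin

context
  fixes z :: "nat \<Rightarrow> 'a \<Rightarrow> 's :: countable" and S :: "'s set"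
  assumes z[measurable]: "\<And>n. z n \<in> M \<rightarrow>\<^sub>M count_space UNIV"
    and S[simp]: "finite S" and z_S: "\<And>n. AE \<omega> in M. z n \<omega> \<in> S"
begin

lemma AE_history_subset: "AE \<omega> in M. \<forall>n. set (history z n \<omega>) \<subseteq> S"
proof -
  have "AE \<omega> in M. \<forall>n. z n \<omega> \<in> S" using z_S by (simp add: AE_all_countable)
  then show ?thesis by eventually_elim (auto simp: history_def)
qed

lemma expectation_history:
  fixes F :: "'s list \<Rightarrow> real"
  shows "expectation (\<lambda>\<omega>. F (history z n \<omega>)) =
    (\<Sum>y | set y \<subseteq> S \<and> length y = n. prob {\<omega> \<in> space M. history z n \<omega> = y} * F y)"
proof -
  let ?L = "{y. set y \<subseteq> S \<and> length y = n}"
  have fin: "finite ?L" by (rule finite_lists_length_eq) simp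
  have "expectation (\<lambda>\<omega>. F (history z n \<omega>)) =
      expectation (\<lambda>\<omega>. \<Sum>y\<in>?L. indicator {\<omega> \<in> space M. history z n \<omega> = y} \<omega> * F y)"
  proof (rule integral_cong_AE)
    show "AE \<omega> in M. F (history z n \<omega>) = (\<Sum>y\<in>?L. indicator {\<omega> \<in> space M. history z n \<omega> = y} \<omega> * F y)"
      using AE_history_subset AE_space
    proof eventually_elim
      case (elim \<omega>)
      have "(\<Sum>y\<in>?L. indicator {\<omega> \<in> space M. history z n \<omega> = y} \<omega> * F y) =
          (\<Sum>y\<in>?L. if y = history z n \<omega> then F y else 0)"
        using elim by (intro sum.cong) (auto simp: indicator_def)
      also have "\<dots> = F (history z n \<omega>)"
        using elim by (simp add: sum.delta[OF fin])
      finally show ?case by simp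
    qed
  qed measurable
  also have "\<dots> = (\<Sum>y\<in>?L. expectation (\<lambda>\<omega>. indicator {\<omega> \<in> space M. history z n \<omega> = y} \<omega> * F y))"
    by (intro Bochner_Integration.integral_sum integrable_mult_left) (auto intro!: integrable_real_indicator simp: emeasure_eq_measure)
  finally show ?thesis by simp
qed

text \<open>The hypothesis is the martingale property multiplied by the probability of the past. In
  this form it needs no conditional expectations and no case distinction for null histories.\<close>

lemma expectation_history_constant:
  fixes H :: "'s list \<Rightarrow> real"
  assumes mean: "\<And>y. set y \<subseteq> S \<Longrightarrow>
      (\<Sum>s\<in>S. prob {\<omega> \<in> space M. history z (Suc (length y)) \<omega> = y @ [s]} * H (y @ [s])) =
      prob {\<omega> \<in> space M. history z (length y) \<omega> = y} * H y"
  shows "expectation (\<lambda>\<omega>. H (history z n \<omega>)) = H []"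
proof (induction n)
  case 0
  show ?case by (simp add: prob_space)
next
  case (Suc n)
  have "expectation (\<lambda>\<omega>. H (history z (Suc n) \<omega>)) = expectation (\<lambda>\<omega>. H (history z n \<omega>))"
    unfolding expectation_history sum_lists_length_Suc using mean by (intro sum.cong) auto
  then show ?case using Suc by simp
qed

text \<open>For \<open>i < j\<close>, fix the first \<open>j\<close> letters: the earlier factor is
  then a constant, and averaging the later one over its last letter gives 0. The variables are thus
  orthogonal.\<close>

lemma martingale_averages_tendsto_zero:
  fixes f :: "'s list \<Rightarrow> real"
  assumes bd: "\<And>y. set y \<subseteq> S \<Longrightarrow> \<bar>f y\<bar> \<le> C"
    and mean: "\<And>y. set y \<subseteq> S \<Longrightarrow>
      (\<Sum>s\<in>S. prob {\<omega> \<in> space M. history z (Suc (length y)) \<omega> = y @ [s]} * f (y @ [s])) = 0"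
  shows "AE \<omega> in M. (\<lambda>n. (\<Sum>i<n. f (history z (Suc i) \<omega>)) / real n) \<longlonglongrightarrow> 0"
proof -
  \<comment> \<open>The bound on \<open>f\<close> holds only for words over \<open>S\<close>, while
    the theorem on averages asks for a bound at every point.\<close>
  define f' where "f' y = (if set y \<subseteq> S then f y else 0)" for y
  have "0 \<le> C" using bd[of "[]"] by simp
  have "AE \<omega> in M. (\<lambda>n. (\<Sum>i<n. f' (history z (Suc i) \<omega>)) / real n) \<longlonglongrightarrow> 0"
  proof (rule bounded_orthogonal_averages_tendsto_zero)
    show "(\<lambda>\<omega>. f' (history z (Suc n) \<omega>)) \<in> borel_measurable M" for n by measurable
    show "\<bar>f' (history z (Suc n) \<omega>)\<bar> \<le> C" for n \<omega> using bd \<open>0 \<le> C\<close> by (simp add: f'_def)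
    fix i j :: nat assume "i < j"
    define G where "G y = f' (take (Suc i) y) * f' y" for y
    have "expectation (\<lambda>\<omega>. f' (history z (Suc i) \<omega>) * f' (history z (Suc j) \<omega>)) =
        expectation (\<lambda>\<omega>. G (history z (Suc j) \<omega>))"
      using \<open>i < j\<close> by (simp add: G_def take_history)
    also have "\<dots> = (\<Sum>y | set y \<subseteq> S \<and> length y = j.
        f' (take (Suc i) y) * (\<Sum>s\<in>S. prob {\<omega> \<in> space M. history z (Suc j) \<omega> = y @ [s]} * f (y @ [s])))"
      unfolding expectation_history sum_lists_length_Suc sum_distrib_left
      using \<open>i < j\<close> by (intro sum.cong) (auto simp: G_def f'_def)
    also have "\<dots> = 0"
      using mean by (intro sum.neutral) auto
    finally show "expectation (\<lambda>\<omega>. f' (history z (Suc i) \<omega>) * f' (history z (Suc j) \<omega>)) = 0" .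
  qed
  with AE_history_subset show ?thesis
    by eventually_elim (simp add: f'_def)
qed

end
end

section \<open>Convergence of the walk\<close>

lemma take_rev_push:
  "take (length v - 1) (rev (push v s)) = take (length v - 1) (rev v)"
  by (cases v) auto

definition state :: "(bool \<times> int) list \<Rightarrow> (bool \<times> int) list" where
  "state y = foldl push [] y"

lemma state_Nil [simp]: "state [] = []"
  and state_snoc [simp]: "state (y @ [s]) = push (state y) s"
  by (simp_all add: state_def)

lemma alternating_state: "set y \<subseteq> letters \<Longrightarrow> alternating (state y)"
  by (induction y rule: rev_induct) (auto intro: alternating_push)

lemma alternating_snoc:
  "alternating (y @ [s]) \<longleftrightarrow> alternating y \<and> s \<in> letters \<and> (y = [] \<or> fst (last y) \<noteq> fst s)"
  by (cases y rule: rev_cases) (auto simp: alternating_def successively_append_iff)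

lemma averages_eventually_const:
  fixes h :: "nat \<Rightarrow> real"
  assumes "\<forall>\<^sub>F i in sequentially. h i = D"
  shows "(\<lambda>n. (\<Sum>i<n. h i) / real n) \<longlonglongrightarrow> D"
proof -
  obtain N where N: "\<And>i. N \<le> i \<Longrightarrow> h i = D" using assms by (auto simp: eventually_sequentially)
  have eq: "(\<Sum>i<n. h i) = D * real n + (\<Sum>i<N. h i - D)" if "N \<le> n" for n
    using that by (induction n rule: dec_induct) (auto simp: sum_subtractf N algebra_simps)
  have "(\<lambda>n. D + (\<Sum>i<N. h i - D) / real n) \<longlonglongrightarrow> D + 0"
    by (intro tendsto_add tendsto_const lim_const_over_n)
  moreover have "\<forall>\<^sub>F n in sequentially. D + (\<Sum>i<N. h i - D) / real n = (\<Sum>i<n. h i) / real n"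
    using eventually_ge_at_top[of N] eventually_gt_at_top[of 0]
    by eventually_elim (simp add: eq field_simps)
  ultimately show ?thesis using Lim_transform_eventually by fastforce
qed

context z3_weights
begin

definition cost :: "bool \<times> int \<Rightarrow> real" where
  "cost s = 1 / 2 + wt s"

abbreviation potential :: "(bool \<times> int) list \<Rightarrow> real" where
  "potential v \<equiv> sum_list (map cost v)"

abbreviation speed :: real where
  "speed \<equiv> 1 / 4 - \<pi>"

text \<open>Every factor without the top letter contributes \<open>2 * speed\<close>, the factor of
  the top letter contributes \<open>- speed\<close>. At the identity there is no top letter, whence
  \<open>4 * speed\<close>.\<close>

definition pot_drift :: "(bool \<times> int) list \<Rightarrow> real" where
  "pot_drift v = (if v = [] then 4 * speed else speed)"

lemma wt_le: "s \<in> letters \<Longrightarrow> wt s \<le> 1 / 2"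
  using wt_sum[of s] wt_nonneg[of "bar s"] by simp

lemma cost_bounds: "s \<in> letters \<Longrightarrow> 1 / 2 \<le> cost s \<and> cost s \<le> 1"
  using wt_le[of s] wt_nonneg[of s] by (simp add: cost_def)

text \<open>The upper bound is the inequality of arithmetic and geometric means for two weights with
  sum 1/2. It gives \<open>3 / 16 \<le> speed\<close>, the source of transience.\<close>

lemma pi_bounds: "0 \<le> \<pi>" "\<pi> \<le> 1 / 16"
proof -
  have s: "(True, 1) \<in> letters" by (simp add: letters_def)
  let ?x = "wt (True, 1)"
  have y: "wt (bar (True, 1)) = 1 / 2 - ?x" using wt_sum[OF s] by simp
  show "0 \<le> \<pi>" using wt_prod[OF s] wt_nonneg[OF s] wt_nonneg[of "bar (True, 1)"] s by (metis mult_nonneg_nonneg bar_in_letters)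
  have "0 \<le> (?x - 1 / 4)\<^sup>2" by simp
  also have "\<dots> = 1 / 16 - \<pi>"
    unfolding wt_prod[OF s, symmetric] y by (simp add: power2_eq_square field_simps)
  finally show "\<pi> \<le> 1 / 16" by simp
qed

lemma wt_cost_sum:
  assumes s: "s \<in> letters"
  shows "wt s * cost s + wt (bar s) * cost (bar s) = 2 * speed"
proof -
  have y: "wt (bar s) = 1 / 2 - wt s" using wt_sum[OF s] by simp
  show ?thesis unfolding cost_def wt_prod[OF s, symmetric] y by (simp add: field_simps)
qed

lemma R_cost_sum:
  assumes s: "s \<in> letters"
  shows "R s * (cost s - \<kappa>) + R (bar s) * (cost (bar s) - \<kappa>) = 0"
proof -
  have y: "R (bar s) = 1 - R s" using R_sum[OF s] by simp
  show ?thesis unfolding cost_def kappa[OF s] y by (simp add: field_simps)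
qed

lemma potential_push_mean:
  assumes "alternating v"
  shows "(\<Sum>s\<in>letters. wt s * (potential (push v s) - potential v - pot_drift v)) = 0"
proof (cases v)
  case Nil
  have t: "(False, 1) \<in> letters" "(True, 1) \<in> letters" "fst (False, 1::int) \<noteq> fst (True, 1::int)"
    by (auto simp: letters_def)
  have eq: "wt s * (cost s - 4 * speed) + wt (bar s) * (cost (bar s) - 4 * speed) = 0" if "s \<in> letters" for s
  proof -
    have y: "wt (bar s) = 1 / 2 - wt s" using wt_sum[OF that] by simp
    show ?thesis using wt_cost_sum[OF that] unfolding y by (simp add: algebra_simps)
  qed
  show ?thesis
    unfolding sum_letters[OF t] using eq[OF t(1)] eq[OF t(2)] by (simp add: Nil pot_drift_def)
next
  case (Cons l v')
  define t where "t = (\<not> fst l, 1::int)"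
  have l: "l \<in> letters" using assms by (simp add: Cons alternating_Cons)
  have t: "t \<in> letters" "fst l \<noteq> fst t" by (auto simp: t_def letters_def)
  have yt: "wt (bar t) = 1 / 2 - wt t" using wt_sum[OF t(1)] by simp
  have yl: "wt (bar l) = 1 / 2 - wt l" using wt_sum[OF l] by simp
  have 1: "wt t * (cost t - speed) + wt (bar t) * (cost (bar t) - speed) = speed * 3 / 2"
    using wt_cost_sum[OF t(1)] unfolding yt by (simp add: algebra_simps)
  have 2: "wt l * (cost (bar l) - cost l - speed) + wt (bar l) * (- cost l - speed) = - speed * 3 / 2"
    unfolding cost_def wt_prod[OF l, symmetric] yl by (simp add: field_simps)
  show ?thesis
    unfolding sum_letters[OF l t] using 1 2 t(2) by (simp add: Cons pot_drift_def)
qed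

lemma potential_push_bound:
  assumes "alternating v" "s \<in> letters"
  shows "\<bar>potential (push v s) - potential v\<bar> \<le> 1"
proof (cases v)
  case Nil
  then show ?thesis using cost_bounds[OF assms(2)] by simp
next
  case (Cons l v')
  then have "l \<in> letters" using assms by (simp add: alternating_Cons)
  then show ?thesis
    using cost_bounds[OF assms(2)] cost_bounds[of l] cost_bounds[of "bar l"] by (simp add: Cons abs_le_iff)
qed

end

text \<open>Independence enters as the product formula for finite histories, the form consumed by
  the martingale lemmas.\<close>

locale z3_walk = prob_space M + z3_weights wt R \<kappa> \<pi>
  for M :: "'w measure" and wt R \<kappa> \<pi> +
  fixes z :: "nat \<Rightarrow> 'w \<Rightarrow> bool \<times> int"
  assumes z_measurable [measurable]: "\<And>n. z n \<in> M \<rightarrow>\<^sub>M count_space UNIV"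
    and z_letters: "\<And>n. AE \<omega> in M. z n \<omega> \<in> letters"
    and prob_history: "\<And>y. set y \<subseteq> letters \<Longrightarrow>
      prob {\<omega> \<in> space M. history z (length y) \<omega> = y} = prod_list (map wt y)"
begin

definition stack :: "nat \<Rightarrow> 'w \<Rightarrow> (bool \<times> int) list" where
  "stack n \<omega> = state (history z n \<omega>)"

lemma stack_0: "stack 0 \<omega> = []"
  and stack_Suc: "stack (Suc n) \<omega> = push (stack n \<omega>) (z n \<omega>)"
  by (simp_all add: stack_def history_Suc)

lemma stack_measurable [measurable]: "stack n \<in> M \<rightarrow>\<^sub>M count_space UNIV"
  unfolding stack_def[abs_def] by measurable

lemma AE_history_letters: "AE \<omega> in M. \<forall>n. set (history z n \<omega>) \<subseteq> letters"
  by (rule AE_history_subset[OF z_measurable finite_letters z_letters])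

lemma AE_stack_alternating: "AE \<omega> in M. \<forall>n. alternating (stack n \<omega>)"
  using AE_history_letters by eventually_elim (auto simp: stack_def intro: alternating_state)

lemma prob_history_snoc:
  assumes "set y \<subseteq> letters" "s \<in> letters"
  shows "prob {\<omega> \<in> space M. history z (Suc (length y)) \<omega> = y @ [s]} = prod_list (map wt y) * wt s"
  using prob_history[of "y @ [s]"] assms by simp

text \<open>The increments of the potential minus \<open>pot_drift\<close> are bounded martingale
  differences, and their sum telescopes.\<close>

lemma AE_potential_asymp:
  "AE \<omega> in M. (\<lambda>n. (potential (stack n \<omega>) - (\<Sum>i<n. pot_drift (stack i \<omega>))) / real n) \<longlonglongrightarrow> 0"
proof -
  define f where "f y = potential (state y) - potential (state (butlast y)) - pot_drift (state (butlast y))" for y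
  have "AE \<omega> in M. (\<lambda>n. (\<Sum>i<n. f (history z (Suc i) \<omega>)) / real n) \<longlonglongrightarrow> 0"
  proof (rule martingale_averages_tendsto_zero[OF z_measurable finite_letters z_letters])
    fix y assume y: "set y \<subseteq> letters"
    have "\<bar>potential (state y) - potential (state (butlast y))\<bar> \<le> 1"
    proof (cases y rule: rev_cases)
      case (snoc y' s)
      then show ?thesis
        using y potential_push_bound[of "state y'" s] alternating_state[of y'] by auto
    qed simp
    moreover have "\<bar>pot_drift (state (butlast y))\<bar> \<le> 1"
      using pi_bounds by (auto simp: pot_drift_def)
    ultimately show "\<bar>f y\<bar> \<le> 2" unfolding f_def by linarith
    have "(\<Sum>s\<in>letters. prob {\<omega> \<in> space M. history z (Suc (length y)) \<omega> = y @ [s]} * f (y @ [s])) =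
        prod_list (map wt y) *
          (\<Sum>s\<in>letters. wt s * (potential (push (state y) s) - potential (state y) - pot_drift (state y)))"
      unfolding sum_distrib_left using y by (intro sum.cong) (auto simp: prob_history_snoc f_def)
    also have "\<dots> = 0" using potential_push_mean[OF alternating_state[OF y]] by simp
    finally show "(\<Sum>s\<in>letters. prob {\<omega> \<in> space M. history z (Suc (length y)) \<omega> = y @ [s]} * f (y @ [s])) = 0" .
  qed
  moreover have "(\<Sum>i<n. f (history z (Suc i) \<omega>)) = potential (stack n \<omega>) - (\<Sum>i<n. pot_drift (stack i \<omega>))" for n \<omega>
    by (induction n) (auto simp: stack_0 stack_Suc f_def history_Suc stack_def)
  ultimately show ?thesis by simp
qed

text \<open>Two rounds: \<open>pot_drift\<close> is at least \<open>speed\<close> everywhere, which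
  forces the length to infinity; the stack is then eventually nonempty, so \<open>pot_drift\<close>
  eventually equals \<open>speed\<close> and the average is exact.\<close>

lemma AE_potential_speed:
  "AE \<omega> in M. filterlim (\<lambda>n. length (stack n \<omega>)) at_top sequentially \<and>
    (\<lambda>n. potential (stack n \<omega>) / real n) \<longlonglongrightarrow> speed"
  using AE_potential_asymp AE_stack_alternating
proof eventually_elim
  case (elim \<omega>)
  let ?e = "\<lambda>n. (potential (stack n \<omega>) - (\<Sum>i<n. pot_drift (stack i \<omega>))) / real n"
  have sp: "0 < speed" using pi_bounds by simp
  have stack: "cost s \<le> 1" if "s \<in> set (stack n \<omega>)" for n s
  proof -
    have "set (stack n \<omega>) \<subseteq> letters" using elim(2) by (auto simp: alternating_def)
    then show ?thesis using that cost_bounds by blast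
  qed
  have len: "filterlim (\<lambda>n. length (stack n \<omega>)) at_top sequentially"
  proof (rule filterlim_length_at_top)
    show "cost s \<le> 1" if "s \<in> set (stack n \<omega>)" for n s using stack that .
    show "0 < speed / 2" using sp by simp
    have "\<forall>\<^sub>F n in sequentially. - (speed / 2) < ?e n"
      using elim(1) sp by (intro order_tendstoD) auto
    then show "\<forall>\<^sub>F n in sequentially. speed / 2 * real n \<le> potential (stack n \<omega>)"
      using eventually_gt_at_top[of 0]
    proof eventually_elim
      case (elim n)
      have "(\<Sum>i<n. speed) \<le> (\<Sum>i<n. pot_drift (stack i \<omega>))"
        using sp by (intro sum_mono) (auto simp: pot_drift_def)
      then have "real n * speed \<le> (\<Sum>i<n. pot_drift (stack i \<omega>))" by simp
      moreover have "- (speed / 2) * real n < potential (stack n \<omega>) - (\<Sum>i<n. pot_drift (stack i \<omega>))"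
        using elim by (simp only: pos_less_divide_eq of_nat_0_less_iff)
      moreover have "speed / 2 * real n = real n * speed - speed / 2 * real n" by (simp add: field_simps)
      ultimately show ?case by linarith
    qed
  qed
  have "\<forall>\<^sub>F i in sequentially. 1 \<le> length (stack i \<omega>)"
    using len by (simp add: filterlim_at_top)
  then have "\<forall>\<^sub>F i in sequentially. pot_drift (stack i \<omega>) = speed"
    by eventually_elim (auto simp: pot_drift_def)
  then have "(\<lambda>n. ?e n + (\<Sum>i<n. pot_drift (stack i \<omega>)) / real n) \<longlonglongrightarrow> 0 + speed"
    by (intro tendsto_add elim averages_eventually_const)
  then have "(\<lambda>n. potential (stack n \<omega>) / real n) \<longlonglongrightarrow> speed"
    by (simp add: diff_divide_distrib)
  with len show ?case by blast
qed

section \<open>The limit word and its law\<close>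

definition lim_at :: "nat \<Rightarrow> bool \<times> int \<Rightarrow> 'w \<Rightarrow> bool" where
  "lim_at k s \<omega> \<longleftrightarrow> (\<forall>\<^sub>F n in sequentially. k < length (stack n \<omega>) \<and> rev (stack n \<omega>) ! k = s)"

text \<open>The default letter \<open>(True, 1)\<close> is used where the walk does not converge; it
  keeps all values in \<open>letters\<close>, so that \<open>lim_word\<close> is a random variable
  in the space of infinite words over \<open>letters\<close>.\<close>

definition lim_letter :: "nat \<Rightarrow> 'w \<Rightarrow> bool \<times> int" where
  "lim_letter k \<omega> = (if \<exists>s\<in>letters. lim_at k s \<omega> then SOME s. s \<in> letters \<and> lim_at k s \<omega> else (True, 1))"

definition lim_word :: "'w \<Rightarrow> (bool \<times> int) stream" where
  "lim_word \<omega> = to_stream (\<lambda>k. lim_letter k \<omega>)"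

lemma lim_word_snth [simp]: "lim_word \<omega> !! k = lim_letter k \<omega>"
  by (simp add: lim_word_def to_stream_def)

lemma lim_at_unique:
  assumes "lim_at k s \<omega>" "lim_at k t \<omega>"
  shows "s = t"
proof -
  have "\<forall>\<^sub>F n in sequentially. s = t"
    using assms unfolding lim_at_def by eventually_elim simp
  then show ?thesis by simp
qed

lemma lim_letter_in: "lim_letter k \<omega> \<in> letters"
proof (cases "\<exists>s\<in>letters. lim_at k s \<omega>")
  case True
  then have "\<exists>s. s \<in> letters \<and> lim_at k s \<omega>" by blast
  from someI_ex[OF this] show ?thesis using True by (simp add: lim_letter_def)
qed (simp add: lim_letter_def letters_def)

lemma lim_letter_eq: "s \<in> letters \<Longrightarrow> lim_at k s \<omega> \<Longrightarrow> lim_letter k \<omega> = s"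
proof -
  assume s: "s \<in> letters" "lim_at k s \<omega>"
  then have "\<exists>s. s \<in> letters \<and> lim_at k s \<omega>" by blast
  from someI_ex[OF this] show ?thesis
    using s lim_at_unique[of k "SOME s. s \<in> letters \<and> lim_at k s \<omega>" \<omega> s] by (auto simp: lim_letter_def)
qed

text \<open>Eliminates the choice operator, so that measurability follows from that of
  \<open>lim_at\<close>.\<close>

lemma lim_letter_iff:
  "lim_letter k \<omega> = s \<longleftrightarrow>
    s \<in> letters \<and> lim_at k s \<omega> \<or> (\<forall>t\<in>letters. \<not> lim_at k t \<omega>) \<and> s = (True, 1)"
proof (cases "\<exists>t\<in>letters. lim_at k t \<omega>")
  case True
  then obtain t where "t \<in> letters" "lim_at k t \<omega>" by blast
  then show ?thesis using lim_letter_eq[of t k \<omega>] lim_at_unique[of k t \<omega> s] by auto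
qed (auto simp: lim_letter_def)

lemma lim_at_measurable [measurable]: "Measurable.pred M (lim_at k s)"
  unfolding lim_at_def[abs_def] eventually_sequentially by measurable

lemma lim_letter_measurable: "lim_letter k \<in> M \<rightarrow>\<^sub>M count_space letters"
proof -
  have "lim_letter k -` {s} \<inter> space M \<in> sets M" for s
  proof -
    have "{\<omega> \<in> space M. lim_letter k \<omega> = s} \<in> sets M"
      unfolding lim_letter_iff by measurable
    then show ?thesis by (simp add: vimage_def Int_def conj_commute)
  qed
  then show ?thesis
    by (simp add: measurable_count_space_eq2 lim_letter_in)
qed

lemma lim_letter_measurable' [measurable]: "lim_letter k \<in> M \<rightarrow>\<^sub>M count_space UNIV"
  using measurable_compose[OF lim_letter_measurable, of "\<lambda>x. x" "count_space UNIV"] by simp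

lemma lim_word_measurable: "lim_word \<in> M \<rightarrow>\<^sub>M infinite_words letters"
  unfolding infinite_words_def
  by (rule measurable_stream_space2) (simp add: lim_letter_measurable)

lemma stake_lim_word: "stake k (lim_word \<omega>) = history lim_letter k \<omega>"
  by (rule nth_equalityI) (auto simp: history_def)

lemma AE_lim_word:
  "AE \<omega> in M. \<forall>k. \<forall>\<^sub>F n in sequentially. take k (rev (stack n \<omega>)) = stake k (lim_word \<omega>)"
  using AE_potential_speed AE_stack_alternating
proof eventually_elim
  case (elim \<omega>)
  let ?g = "\<lambda>n. rev (stack n \<omega>)"
  have lim: "lim_at k (lim_letter k \<omega>) \<omega>" for k
  proof -
    have "\<forall>\<^sub>F n in sequentially. Suc (Suc k) \<le> length (stack n \<omega>)"
      using elim(1) by (simp add: filterlim_at_top)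
    \<comment> \<open>Position \<open>k\<close> must stay below the last letter, hence
      \<open>Suc k\<close> rather than \<open>k\<close> on the left.\<close>
    then obtain N where N: "\<And>n. N \<le> n \<Longrightarrow> Suc k < length (?g n)"
      by (auto simp: eventually_sequentially Suc_le_eq)
    have nth: "?g n ! k = ?g N ! k" if "N \<le> n" for n
    proof -
      have "take (Suc k) (?g n) = take (Suc k) (?g N)"
      proof (rule take_stable[OF _ _ that])
        show "take (length (?g n) - 1) (?g (Suc n)) = take (length (?g n) - 1) (?g n)" for n
          using take_rev_push by (simp add: stack_Suc)
      qed (use N in auto)
      then show ?thesis by (metis lessI nth_take)
    qed
    have "lim_at k (?g N ! k) \<omega>"
      unfolding lim_at_def
    proof (rule eventually_sequentiallyI)
      fix n assume "N \<le> n"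
      then show "k < length (stack n \<omega>) \<and> ?g n ! k = ?g N ! k"
        using N[of n] nth[of n] by (simp only: length_rev, simp)
    qed
    moreover have "?g N ! k \<in> letters"
    proof -
      have "?g N ! k \<in> set (?g N)" using N[of N] by (intro nth_mem) simp
      then show ?thesis using elim(2) by (auto simp: alternating_def)
    qed
    ultimately show ?thesis using lim_letter_eq by metis
  qed
  show ?case
  proof
    fix k
    have "\<forall>\<^sub>F n in sequentially. \<forall>i\<in>{..<k}. i < length (stack n \<omega>) \<and> ?g n ! i = lim_letter i \<omega>"
      using lim unfolding lim_at_def by (intro eventually_ball_finite) auto
    moreover have "\<forall>\<^sub>F n in sequentially. k \<le> length (stack n \<omega>)"
      using elim(1) by (simp add: filterlim_at_top)
    ultimately show "\<forall>\<^sub>F n in sequentially. take k (?g n) = stake k (lim_word \<omega>)"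
      by eventually_elim (auto intro!: nth_equalityI)
  qed
qed

lemma AE_lim_word_alternating: "AE \<omega> in M. \<forall>k. alternating (stake k (lim_word \<omega>))"
  using AE_lim_word AE_stack_alternating
proof eventually_elim
  case (elim \<omega>)
  show ?case
  proof
    fix k
    obtain n where "take k (rev (stack n \<omega>)) = stake k (lim_word \<omega>)"
      using elim(1) unfolding eventually_sequentially by blast
    then show "alternating (stake k (lim_word \<omega>))"
      using elim(2) alternating_prefix[OF _ take_is_prefix] alternating_rev by metis
  qed
qed

text \<open>By harmonicity the expectation of \<open>cyl_harmonic w\<close> along the walk keeps its
  value at the identity, which is the claimed mass. Dominated convergence identifies it with the
  probability of the limit event, so no martingale convergence theorem enters.\<close>

lemma prob_lim_word:
  assumes w: "alternating w" "w \<noteq> []"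
  shows "prob {\<omega> \<in> space M. stake (length w) (lim_word \<omega>) = w} = prod_list (map R w) / 2"
proof -
  define A where "A = {\<omega> \<in> space M. stake (length w) (lim_word \<omega>) = w}"
  have A[measurable]: "A \<in> sets M"
    unfolding A_def stake_lim_word by measurable
  have const: "expectation (\<lambda>\<omega>. cyl_harmonic w (stack n \<omega>)) = prod_list (map R w) / 2" for n
  proof -
    have "expectation (\<lambda>\<omega>. cyl_harmonic w (state (history z n \<omega>))) = cyl_harmonic w (state [])"
    proof (rule expectation_history_constant[OF z_measurable finite_letters z_letters])
      fix y assume y: "set y \<subseteq> letters"
      have "(\<Sum>s\<in>letters. prob {\<omega> \<in> space M. history z (Suc (length y)) \<omega> = y @ [s]} * cyl_harmonic w (state (y @ [s]))) =
          prod_list (map wt y) * (\<Sum>s\<in>letters. wt s * cyl_harmonic w (push (state y) s))"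
        unfolding sum_distrib_left using y by (intro sum.cong) (auto simp: prob_history_snoc)
      also have "\<dots> = prob {\<omega> \<in> space M. history z (length y) \<omega> = y} * cyl_harmonic w (state y)"
        using prob_history[OF y] cyl_harmonic_mean[OF w(1) alternating_state[OF y]] by simp
      finally show "(\<Sum>s\<in>letters. prob {\<omega> \<in> space M. history z (Suc (length y)) \<omega> = y @ [s]} * cyl_harmonic w (state (y @ [s]))) =
          prob {\<omega> \<in> space M. history z (length y) \<omega> = y} * cyl_harmonic w (state y)" .
    qed
    then show ?thesis using cyl_harmonic_Nil[OF w] by (simp add: stack_def)
  qed
  have "(\<lambda>n. expectation (\<lambda>\<omega>. cyl_harmonic w (stack n \<omega>))) \<longlonglongrightarrow> expectation (indicator A)"
  proof (rule integral_dominated_convergence[where w = "\<lambda>_. 1"])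
    show "AE \<omega> in M. norm (cyl_harmonic w (stack n \<omega>)) \<le> 1" for n
      using AE_stack_alternating by eventually_elim (simp add: cyl_harmonic_bounds[OF w(1)])
    show "AE \<omega> in M. (\<lambda>n. cyl_harmonic w (stack n \<omega>)) \<longlonglongrightarrow> indicator A \<omega>"
      using AE_stack_alternating AE_potential_speed AE_lim_word AE_space
    proof eventually_elim
      case (elim \<omega>)
      have "filterlim (\<lambda>n. length (stack n \<omega>) - length w) at_top sequentially"
        unfolding filterlim_at_top
      proof
        fix Z
        have "\<forall>\<^sub>F n in sequentially. Z + length w \<le> length (stack n \<omega>)"
          using elim(2) by (simp add: filterlim_at_top)
        then show "\<forall>\<^sub>F n in sequentially. Z \<le> length (stack n \<omega>) - length w"
          by eventually_elim simp
      qed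
      then have lim: "(\<lambda>n. rho ^ (length (stack n \<omega>) - length w)) \<longlonglongrightarrow> 0"
        using rho_bounds by (intro filterlim_compose[OF LIMSEQ_power_zero]) auto
      have "\<forall>\<^sub>F n in sequentially. length w \<le> length (stack n \<omega>)"
        using elim(2) by (simp add: filterlim_at_top)
      moreover have "\<forall>\<^sub>F n in sequentially. take (length w) (rev (stack n \<omega>)) = stake (length w) (lim_word \<omega>)"
        using elim(3) by blast
      ultimately have "\<forall>\<^sub>F n in sequentially. norm (cyl_harmonic w (stack n \<omega>) - indicator A \<omega>) \<le> rho ^ (length (stack n \<omega>) - length w)"
      proof eventually_elim
        case (elim n)
        \<comment> \<open>The first \<open>length w\<close> letters have already settled at this
          time.\<close>
        have "prefix w (rev (stack n \<omega>)) \<longleftrightarrow> \<omega> \<in> A"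
          using elim \<open>\<omega> \<in> space M\<close> by (auto simp: A_def prefix_def take_is_prefix) (metis append_take_drop_id)
        then have "indicator A \<omega> = (of_bool (prefix w (rev (stack n \<omega>))) :: real)" by (simp add: indicator_def)
        then show ?case
          using cyl_harmonic_approx[OF w(1) _ elim(1)] \<open>\<forall>n. alternating (stack n \<omega>)\<close> by simp
      qed
      from Lim_null_comparison[OF this lim] show ?case by (rule LIM_zero_cancel)
    qed
  qed simp_all
  moreover have "expectation (indicator A) = prob A" by simp
  ultimately have "(\<lambda>n. prod_list (map R w) / 2) \<longlonglongrightarrow> prob A" unfolding const by simp
  then show ?thesis unfolding A_def[symmetric] using LIMSEQ_unique[OF tendsto_const] by metis
qed

text \<open>The factors of successive letters alternate, so the letters are not independent. Given
  the past, however, the next letter has law \<open>R\<close> within its factor, and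
  \<open>cost - \<kappa>\<close> has mean 0 there.\<close>

lemma AE_lim_word_potential:
  "AE \<omega> in M. (\<lambda>k. potential (stake k (lim_word \<omega>)) / real k) \<longlonglongrightarrow> \<kappa>"
proof -
  define f where "f y = (if y = [] then 0 else cost (last y) - \<kappa>)" for y
  have z_letters': "AE \<omega> in M. lim_letter n \<omega> \<in> letters" for n by (simp add: lim_letter_in)
  have "AE \<omega> in M. (\<lambda>n. (\<Sum>i<n. f (history lim_letter (Suc i) \<omega>)) / real n) \<longlonglongrightarrow> 0"
  proof (rule martingale_averages_tendsto_zero[OF lim_letter_measurable' finite_letters z_letters'])
    fix y assume y: "set y \<subseteq> letters"
    show "\<bar>f y\<bar> \<le> 1 + \<kappa>"
    proof (cases "y = []")
      case False
      then have "last y \<in> letters" using y last_in_set by blast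
      then show ?thesis using cost_bounds[of "last y"] kappa_pos by (auto simp: f_def abs_le_iff)
    qed (use kappa_pos in \<open>simp add: f_def\<close>)
    have P: "prob {\<omega> \<in> space M. history lim_letter (Suc (length y)) \<omega> = y @ [s]} =
        (if alternating (y @ [s]) then prod_list (map R y) * R s / 2 else 0)" if "s \<in> letters" for s
    proof (cases "alternating (y @ [s])")
      case True
      then show ?thesis using prob_lim_word[OF True] by (simp add: stake_lim_word)
    next
      case False
      have "prob {\<omega> \<in> space M. history lim_letter (Suc (length y)) \<omega> = y @ [s]} = 0"
      proof (rule prob_eq_0_AE)
        show "AE \<omega> in M. \<not> history lim_letter (Suc (length y)) \<omega> = y @ [s]"
          using AE_lim_word_alternating
        proof eventually_elim
          case (elim \<omega>)
          then have "alternating (history lim_letter (Suc (length y)) \<omega>)" by (simp only: stake_lim_word)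
          with False show ?case by metis
        qed
      qed
      with False show ?thesis by simp
    qed
    have "(\<Sum>s\<in>letters. prob {\<omega> \<in> space M. history lim_letter (Suc (length y)) \<omega> = y @ [s]} * f (y @ [s])) =
       (\<Sum>s\<in>letters. (if alternating (y @ [s]) then prod_list (map R y) * R s / 2 else 0) * (cost s - \<kappa>))"
      using P by (intro sum.cong) (auto simp: f_def)
    also have "\<dots> = 0"
    proof -
      \<comment> \<open>For empty \<open>y\<close> both factors are possible and \<open>l\<close>
        merely names one of them. The two letters of each factor cancel separately, which covers
        both cases.\<close>
      define l where "l = (if y = [] then (True, 1) else last y)"
      define t where "t = (\<not> fst l, 1::int)"
      have l: "l \<in> letters" using y last_in_set[of y] by (auto simp: l_def letters_def)
      have t: "t \<in> letters" "fst l \<noteq> fst t" by (auto simp: t_def letters_def)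
      have pair: "prod_list (map R y) * R s / 2 * (cost s - \<kappa>) + prod_list (map R y) * R (bar s) / 2 * (cost (bar s) - \<kappa>) = 0"
        if "s \<in> letters" for s
      proof -
        have "prod_list (map R y) * R s / 2 * (cost s - \<kappa>) + prod_list (map R y) * R (bar s) / 2 * (cost (bar s) - \<kappa>)
          = prod_list (map R y) / 2 * (R s * (cost s - \<kappa>) + R (bar s) * (cost (bar s) - \<kappa>))"
          by (simp add: algebra_simps add_divide_distrib diff_divide_distrib)
        then show ?thesis using R_cost_sum[OF that] by simp
      qed
      show ?thesis
        unfolding sum_letters[OF l t]
        using pair[OF l] pair[OF t(1)] l t by (auto simp: alternating_snoc l_def)
    qed
    finally show "(\<Sum>s\<in>letters. prob {\<omega> \<in> space M. history lim_letter (Suc (length y)) \<omega> = y @ [s]} * f (y @ [s])) = 0" .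
  qed
  then show ?thesis
  proof eventually_elim
    case (elim \<omega>)
    have "(\<Sum>i<n. f (history lim_letter (Suc i) \<omega>)) = potential (stake n (lim_word \<omega>)) - \<kappa> * real n" for n
      by (induction n) (auto simp: f_def stake_lim_word history_Suc algebra_simps)
    with elim have "(\<lambda>n. (potential (stake n (lim_word \<omega>)) - \<kappa> * real n) / real n + \<kappa>) \<longlonglongrightarrow> 0 + \<kappa>"
      by (intro tendsto_add) auto
    moreover have "\<forall>\<^sub>F n in sequentially. (potential (stake n (lim_word \<omega>)) - \<kappa> * real n) / real n + \<kappa>
        = potential (stake n (lim_word \<omega>)) / real n"
      using eventually_gt_at_top[of 0] by eventually_elim (simp add: field_simps)
    ultimately show ?case using Lim_transform_eventually by fastforce
  qed
qed

theorem AE_length_speed: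
  "AE \<omega> in M. (\<lambda>n. real (length (stack n \<omega>)) / real n) \<longlonglongrightarrow> speed / \<kappa>"
  using AE_potential_speed AE_lim_word AE_lim_word_potential AE_stack_alternating
proof eventually_elim
  case (elim \<omega>)
  have "(\<lambda>n. real (length (rev (stack n \<omega>))) / real n) \<longlonglongrightarrow> speed / \<kappa>"
  proof (rule length_div_tendsto)
    show "1 / 2 \<le> cost s \<and> cost s \<le> 1" if "s \<in> set (rev (stack n \<omega>))" for n s
    proof -
      have "set (stack n \<omega>) \<subseteq> letters" using elim(4) by (auto simp: alternating_def)
      with that have "s \<in> letters" by auto
      then show ?thesis by (rule cost_bounds)
    qed
    show "take (length (rev (stack n \<omega>)) - 1) (rev (stack (Suc n) \<omega>)) = take (length (rev (stack n \<omega>)) - 1) (rev (stack n \<omega>))" for n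
      using take_rev_push by (simp add: stack_Suc)
    show "(\<lambda>n. potential (rev (stack n \<omega>)) / real n) \<longlonglongrightarrow> speed"
      using elim(1) by (simp add: rev_map[symmetric])
  qed (use elim pi_bounds kappa_pos in auto)
  then show ?case by simp
qed

end

section \<open>Harmonic measure and drift\<close>

text \<open>The right side includes the bound on \<open>k\<close>: if \<open>w\<close> is too short,
  \<open>take k w\<close> has fewer than \<open>k\<close> letters and differs from
  \<open>stake k \<xi>\<close>.\<close>

lemma le_common_prefix_length_iff: "k \<le> common_prefix_length w \<xi> \<longleftrightarrow> take k w = stake k \<xi>"
proof -
  let ?p = "longest_common_prefix w (stake (length w) \<xi>)"
  have pre: "prefix ?p w" "prefix ?p (stake (length w) \<xi>)"
    by (rule longest_common_prefix_prefix1, rule longest_common_prefix_prefix2)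
  have take_eq: "take k q = take k v" if "prefix q v" "k \<le> length q" for q v :: "'a list"
    using that by (auto simp: prefix_def)
  show ?thesis
  proof
    assume "k \<le> common_prefix_length w \<xi>"
    then have k: "k \<le> length ?p" by (simp add: common_prefix_length_def)
    then have "k \<le> length w" using prefix_length_le[OF pre(1)] by simp
    then have "stake k \<xi> = take k (stake (length w) \<xi>)" by (simp add: take_stake min_def)
    also have "\<dots> = take k ?p" using take_eq[OF pre(2) k] by simp
    also have "\<dots> = take k w" using take_eq[OF pre(1) k] .
    finally show "take k w = stake k \<xi>" by simp
  next
    assume eq: "take k w = stake k \<xi>"
    then have k: "k \<le> length w" by (metis length_stake length_take min.absorb_iff2 min.commute)
    have "take k w = take k (stake (length w) \<xi>)" using k by (simp add: eq take_stake min_def)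
    then have "prefix (take k w) (stake (length w) \<xi>)" by (simp add: take_is_prefix)
    then have "prefix (take k w) ?p"
      by (intro longest_common_prefix_max_prefix take_is_prefix)
    then show "k \<le> common_prefix_length w \<xi>"
      using k prefix_length_le by (fastforce simp: common_prefix_length_def)
  qed
qed

lemma word_limit_iff: "word_limit w \<xi> \<longleftrightarrow> (\<forall>k. \<forall>\<^sub>F n in sequentially. take k (w n) = stake k \<xi>)"
  by (simp add: word_limit_def filterlim_at_top le_common_prefix_length_iff)

lemma word_limit_unique:
  assumes "word_limit w \<xi>" "word_limit w \<xi>'"
  shows "\<xi> = \<xi>'"
proof -
  have "stake k \<xi> = stake k \<xi>'" for k
  proof -
    have "\<forall>\<^sub>F n in sequentially. stake k \<xi> = stake k \<xi>'"
      using assms[unfolded word_limit_iff, rule_format, of k] by eventually_elim simp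
    then show ?thesis by simp
  qed
  then have "\<xi> !! k = \<xi>' !! k" for k by (metis lessI stake_nth)
  then have "snth \<xi> = snth \<xi>'" by (rule ext)
  then show ?thesis by (metis stream_smap_nats)
qed

lemma sets_cylinder: "cylinder S w \<in> sets (infinite_words S)"
proof -
  have "cylinder S w = {\<xi> \<in> space (infinite_words S). \<forall>i\<in>{..<length w}. \<xi> !! i = w ! i}"
    by (auto simp: cylinder_def infinite_words_def space_stream_space list_eq_iff_nth_eq)
  also have "\<dots> \<in> sets (infinite_words S)"
    unfolding infinite_words_def by measurable
  finally show ?thesis .
qed

text \<open>Every denominator is the mass 1/2 of the opposite factor, which turns \<open>r\<close>
  into \<open>R\<close>; the last letter has no denominator and leaves the factor 1/2.\<close>

lemma mm_weight_half:
  assumes "set w \<subseteq> letters" "w \<noteq> []"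
    and r: "\<And>s. s \<in> letters \<Longrightarrow> r s = R s / 2" and R: "\<And>s. s \<in> letters \<Longrightarrow> R s + R (bar s) = 1"
  shows "mm_weight letters r w = prod_list (map R w) / 2"
proof -
  have other: "(\<Sum>v | v \<in> letters \<and> fst v \<noteq> fst u. r v) = 1 / 2" for u
  proof -
    define t where "t = (\<not> fst u, 1::int)"
    have t: "t \<in> letters" "bar t \<in> letters" by (auto simp: t_def letters_def bar_def)
    have "{v. v \<in> letters \<and> fst v \<noteq> fst u} = {t, bar t}"
      by (auto simp: t_def letters_def bar_def)
    then show ?thesis using r[OF t(1)] r[OF t(2)] R[OF t(1)] by simp
  qed
  obtain w' s where w: "w = w' @ [s]" using assms(2) by (cases w rule: rev_cases) auto
  have "mm_weight letters r w = (\<Prod>j<length w'. R (w' ! j)) * (R s / 2)"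
  proof -
    have "R (w' ! j) = r (w ! j) / (1 / 2)" if "j < length w'" for j
    proof -
      have "w' ! j \<in> letters" using nth_mem[OF that] assms(1) by (auto simp: w)
      then show ?thesis using r[of "w' ! j"] that by (simp add: w nth_append)
    qed
    moreover have "r s = R s / 2" using assms(1) r by (simp add: w)
    ultimately show ?thesis
      unfolding mm_weight_def other by (simp add: w)
  qed
  also have "(\<Prod>j<length w'. R (w' ! j)) = prod_list (map R w')"
    by (simp add: prod.list_conv_set_nth atLeast0LessThan)
  finally show ?thesis by (simp add: w)
qed

context z3_walk
begin

lemma AE_word_limit_lim_word: "AE \<omega> in M. word_limit (\<lambda>n. rev (stack n \<omega>)) (lim_word \<omega>)"
  using AE_lim_word by (simp add: word_limit_iff)

text \<open>Limits of a sequence of words are unique, so any admissible limit variable agrees almost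
  surely with \<open>lim_word\<close>. This yields existence and uniqueness of the harmonic measure
  at once.\<close>

lemma harmonic_measure_iff:
  assumes X: "AE \<omega> in M. \<forall>n. X n \<omega> = rev (stack n \<omega>)"
  shows "harmonic_measure M letters X \<nu> \<longleftrightarrow> \<nu> = distr M (infinite_words letters) lim_word"
proof
  assume "harmonic_measure M letters X \<nu>"
  then obtain Y where Y: "Y \<in> M \<rightarrow>\<^sub>M infinite_words letters"
    "AE \<omega> in M. word_limit (\<lambda>n. X n \<omega>) (Y \<omega>)" "\<nu> = distr M (infinite_words letters) Y"
    unfolding harmonic_measure_def by blast
  have "AE \<omega> in M. Y \<omega> = lim_word \<omega>"
    using Y(2) X AE_word_limit_lim_word by eventually_elim (auto intro: word_limit_unique)
  then show "\<nu> = distr M (infinite_words letters) lim_word"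
    unfolding Y(3) using Y(1) lim_word_measurable by (intro distr_cong_AE) auto
next
  have "AE \<omega> in M. word_limit (\<lambda>n. X n \<omega>) (lim_word \<omega>)"
    using X AE_word_limit_lim_word by eventually_elim simp
  then show "\<nu> = distr M (infinite_words letters) lim_word \<Longrightarrow> harmonic_measure M letters X \<nu>"
    unfolding harmonic_measure_def using lim_word_measurable by blast
qed

lemma markovian_multiplicative_lim_word:
  assumes r: "\<And>s. s \<in> letters \<Longrightarrow> r s = R s / 2"
  shows "markovian_multiplicative letters r (distr M (infinite_words letters) lim_word)"
proof -
  have t: "(False, 1) \<in> letters" "(True, 1) \<in> letters" "fst (False, 1::int) \<noteq> fst (True, 1::int)"
    by (auto simp: letters_def)
  have half: "r s + r (bar s) = 1 / 2" if "s \<in> letters" for s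
    using R_sum[OF that] r[OF that] r[of "bar s"] that by simp
  have "(\<Sum>u\<in>letters. r u) = 1"
    unfolding sum_letters[OF t] half[OF t(1)] half[OF t(2)] by simp
  moreover have "emeasure (distr M (infinite_words letters) lim_word) (cylinder letters w) = ennreal (mm_weight letters r w)"
    if w: "w \<noteq> []" "set w \<subseteq> letters" "successively (\<lambda>x y. fst x \<noteq> fst y) w" for w
  proof -
    have vimage: "lim_word -` cylinder letters w \<inter> space M = {\<omega> \<in> space M. stake (length w) (lim_word \<omega>) = w}"
      using lim_letter_in by (auto simp: cylinder_def streams_iff_snth)
    have "alternating w" using w by (simp add: alternating_def)
    note prob_lim_word[OF this w(1)]
    moreover have "mm_weight letters r w = prod_list (map R w) / 2"
      by (rule mm_weight_half) (use w r R_sum in auto)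
    ultimately show ?thesis
      unfolding emeasure_distr[OF lim_word_measurable sets_cylinder] vimage emeasure_eq_measure
      by (simp only:)
  qed
  moreover have "\<forall>u\<in>letters. 0 < r u" 
  proof
    fix u assume "u \<in> letters"
    then show "0 < r u" using r[of u] R_pos[of u] by simp
  qed
  ultimately show ?thesis
    unfolding markovian_multiplicative_def by simp
qed

end

section \<open>From steps in the group to random letters\<close>

lemma random_walk_steps_AE_singleton:
  assumes steps: "random_walk_steps M \<mu> x" and supp: "set_pmf \<mu> \<subseteq> (\<lambda>s. [s]) ` letters"
  shows "AE \<omega> in M. \<forall>n. x n \<omega> = [hd (x n \<omega>)] \<and> hd (x n \<omega>) \<in> letters"
proof -
  interpret prob_space M using steps by (simp add: random_walk_steps_def)
  have "AE \<omega> in M. x n \<omega> \<in> set_pmf \<mu>" for n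
  proof (rule AE_distrD[where f = "x n" and M' = "count_space UNIV" and P = "\<lambda>g. g \<in> set_pmf \<mu>"])
    show "x n \<in> M \<rightarrow>\<^sub>M count_space UNIV"
      using steps by (simp add: random_walk_steps_def indep_vars_def)
    show "AE g in distr M (count_space UNIV) (x n). g \<in> set_pmf \<mu>"
    proof -
      have "distr M (count_space UNIV) (x n) = measure_pmf \<mu>"
        using steps by (simp add: random_walk_steps_def)
      then show ?thesis using AE_measure_pmf[of \<mu>] by (simp only:)
    qed
  qed
  then have "AE \<omega> in M. \<forall>n. x n \<omega> \<in> set_pmf \<mu>" by (simp add: AE_all_countable)
  then show ?thesis
  proof eventually_elim
    case (elim \<omega>)
    then have "x n \<omega> \<in> (\<lambda>s. [s]) ` letters" for n using supp by blast
    then show ?case by (metis (no_types, lifting) imageE list.sel(1))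
  qed
qed

lemma z3_walk_random_walk_steps:
  assumes steps: "random_walk_steps M \<mu> x" and supp: "set_pmf \<mu> \<subseteq> (\<lambda>s. [s]) ` letters"
    and "z3_weights (\<lambda>s. pmf \<mu> [s]) R \<kappa> \<pi>"
  shows "z3_walk M (\<lambda>s. pmf \<mu> [s]) R \<kappa> \<pi> (\<lambda>n \<omega>. hd (x n \<omega>))"
proof -
  interpret prob_space M using steps by (simp add: random_walk_steps_def)
  interpret z3_weights "\<lambda>s. pmf \<mu> [s]" R \<kappa> \<pi> by fact
  have indep: "indep_vars (\<lambda>_. count_space UNIV) x UNIV"
    and law: "\<And>n. distr M (count_space UNIV) (x n) = measure_pmf \<mu>"
    using steps by (auto simp: random_walk_steps_def)
  have x[measurable]: "x n \<in> M \<rightarrow>\<^sub>M count_space UNIV" for n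
    using indep by (simp add: indep_vars_def)
  note AE = random_walk_steps_AE_singleton[OF steps supp]
  have z[measurable]: "(\<lambda>\<omega>. hd (x n \<omega>)) \<in> M \<rightarrow>\<^sub>M count_space UNIV" for n
    by measurable
  show ?thesis
  proof unfold_locales
    show "AE \<omega> in M. hd (x n \<omega>) \<in> letters" for n using AE by eventually_elim simp
    fix y :: "(bool \<times> int) list"
    show "prob {\<omega> \<in> space M. history (\<lambda>n \<omega>. hd (x n \<omega>)) (length y) \<omega> = y} = (\<Prod>s\<leftarrow>y. pmf \<mu> [s])"
    \<comment> \<open>The intersection of events over no index need not be contained in
      \<open>space M\<close>, so the empty history is treated apart.\<close>
    proof (cases "y = []")
      case False
      have "prob {\<omega> \<in> space M. history (\<lambda>n \<omega>. hd (x n \<omega>)) (length y) \<omega> = y} =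
          prob (\<Inter>i\<in>{..<length y}. x i -` {[y ! i]} \<inter> space M)"
      proof (rule finite_measure_eq_AE)
        show "AE \<omega> in M. \<omega> \<in> {\<omega> \<in> space M. history (\<lambda>n \<omega>. hd (x n \<omega>)) (length y) \<omega> = y} \<longleftrightarrow>
            \<omega> \<in> (\<Inter>i\<in>{..<length y}. x i -` {[y ! i]} \<inter> space M)"
          using AE AE_space
        proof eventually_elim
          case (elim \<omega>)
          have 1: "x i \<omega> = [y ! i] \<longleftrightarrow> hd (x i \<omega>) = y ! i" for i
            using elim(1) by (metis list.sel(1))
          have 2: "history (\<lambda>n \<omega>. hd (x n \<omega>)) (length y) \<omega> = y \<longleftrightarrow> (\<forall>i<length y. hd (x i \<omega>) = y ! i)"
            unfolding history_def by (subst list_eq_iff_nth_eq) auto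
          have 3: "\<omega> \<in> (\<Inter>i\<in>{..<length y}. x i -` {[y ! i]} \<inter> space M) \<longleftrightarrow> (\<forall>i<length y. x i \<omega> = [y ! i])"
            using elim(2) False by auto
          show ?case unfolding 3 1 using elim(2) 2 by blast
        qed
        show "(\<Inter>i\<in>{..<length y}. x i -` {[y ! i]} \<inter> space M) \<in> sets M"
          using False by (intro sets.finite_INT measurable_sets[OF x]) auto
      qed measurable
      also have "\<dots> = (\<Prod>i<length y. prob (x i -` {[y ! i]} \<inter> space M))"
        using False by (intro indep_varsD[OF indep]) auto
      also have "\<dots> = (\<Prod>i<length y. pmf \<mu> [y ! i])"
      proof (intro prod.cong refl)
        fix i
        have "prob (x i -` {[y ! i]} \<inter> space M) = measure (distr M (count_space UNIV) (x i)) {[y ! i]}"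
          by (simp add: measure_distr)
        then show "prob (x i -` {[y ! i]} \<inter> space M) = pmf \<mu> [y ! i]"
          by (simp add: law measure_pmf_single)
      qed
      also have "\<dots> = (\<Prod>s\<leftarrow>y. pmf \<mu> [s])"
        by (simp add: prod.list_conv_set_nth atLeast0LessThan)
      finally show ?thesis .
    qed (simp add: prob_space)
  qed measurable
qed

lemma walk_eq_rev_stack:
  assumes "z3_walk M wt R \<kappa> \<pi> (\<lambda>n \<omega>. hd (x n \<omega>))"
    and "AE \<omega> in M. \<forall>n. x n \<omega> = [hd (x n \<omega>)] \<and> hd (x n \<omega>) \<in> letters"
  shows "AE \<omega> in M. \<forall>n. walk Z3_Z3 x n \<omega> = rev (z3_walk.stack (\<lambda>n \<omega>. hd (x n \<omega>)) n \<omega>)"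
proof -
  interpret z3_walk M wt R \<kappa> \<pi> "\<lambda>n \<omega>. hd (x n \<omega>)" by fact
  show ?thesis
    using assms(2) AE_stack_alternating
  proof eventually_elim
    case (elim \<omega>)
    show ?case
    proof
      fix n
      show "walk Z3_Z3 x n \<omega> = rev (stack n \<omega>)"
      proof (induction n)
        case (Suc n)
        have "walk Z3_Z3 x (Suc n) \<omega> = foldr (fp_lmult (\<lambda>_. Z3)) (rev (stack n \<omega>)) [hd (x n \<omega>)]"
          using elim(1) Suc by (metis free_product_simps(2) walk.simps(2))
        also have "\<dots> = rev (push (stack n \<omega>) (hd (x n \<omega>)))"
          using elim by (intro mult_letter_eq_push) auto
        finally show ?case by (simp only: stack_Suc)
      qed (simp add: stack_0)
    qed
  qed
qed

text \<open>A generator is 1 or 2, and doubling modulo 3 exchanges these. Hence any choice of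
  generators is covered by \<open>bar\<close>.\<close>

lemma generator_Z3:
  assumes "generate Z3 {\<alpha>} = carrier Z3"
  shows "(i, \<alpha>) \<in> letters" "(i, \<alpha> \<otimes>\<^bsub>Z3\<^esub> \<alpha>) = bar (i, \<alpha>)"
proof -
  have carrier: "carrier Z3 = {0..<3}" by (simp add: carrier_integer_mod_group)
  have "\<alpha> \<in> generate Z3 {\<alpha>}" by (rule generate.incl) simp
  then have \<alpha>: "0 \<le> \<alpha>" "\<alpha> < 3" by (auto simp: assms carrier)
  have "\<alpha> \<noteq> 0"
  proof
    assume "\<alpha> = 0"
    then have "generate Z3 {\<alpha>} = {0}"
      using group.generate_one[OF group_integer_mod_group[of 3]] by simp
    moreover have "(1 :: int) \<in> carrier Z3" by (simp add: carrier)
    ultimately show False by (simp add: assms)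
  qed
  with \<alpha> have "\<alpha> = 1 \<or> \<alpha> = 2" by auto
  then show "(i, \<alpha>) \<in> letters" "(i, \<alpha> \<otimes>\<^bsub>Z3\<^esub> \<alpha>) = bar (i, \<alpha>)"
    by (auto simp: letters_def bar_def mult_integer_mod_group)
qed

text \<open>Eliminating \<open>\<kappa>\<close> from the stationarity equations leaves
  \<open>(4 * p - 1) * x\<^sup>2 + (3 - 4 * p) * x - 1 = 0\<close> for \<open>x = R a\<close>, with
  discriminant \<open>s\<^sup>2\<close>. Its root \<open>(4 * p - 3 + s) / (2 * (4 * p - 1))\<close>
  is used in the rationalised form \<open>2 / (3 - 4 * p + s)\<close>, which is also valid at
  \<open>p = 1/4\<close>.\<close>

lemma weight_identities:
  fixes p s :: real
  assumes p: "0 \<le> p" "p \<le> 1 / 2" and s: "s = sqrt (16 * p\<^sup>2 - 8 * p + 5)"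
  shows "s\<^sup>2 = 16 * p\<^sup>2 - 8 * p + 5" "2 \<le> s"
    "2 / (3 - 4 * p + s) + 2 / (1 + 4 * p + s) = 1"
    "p + (1 / 2 - p) * (2 / (1 + 4 * p + s)) = (1 + s) / 4 * (2 / (3 - 4 * p + s))"
    "(1 / 2 - p) + p * (2 / (3 - 4 * p + s)) = (1 + s) / 4 * (2 / (1 + 4 * p + s))"
    "p \<noteq> 1 / 4 \<Longrightarrow> (4 * p - 3 + s) / (4 * (4 * p - 1)) = 2 / (3 - 4 * p + s) / 2"
    "p \<noteq> 1 / 4 \<Longrightarrow> (4 * p + 1 - s) / (4 * (4 * p - 1)) = 2 / (1 + 4 * p + s) / 2"
    "(1 / 4 - p * (1 / 2 - p)) / ((1 + s) / 4) = - 1 / 4 + 1 / 4 * s"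
proof -
  \<comment> \<open>Completing the square gives \<open>2 \<le> s\<close>, which keeps both
    denominators positive for \<open>p\<close> between 0 and 1/2.\<close>
  have sq: "16 * p\<^sup>2 - 8 * p + 5 = (4 * p - 1)\<^sup>2 + 4" by (simp add: power2_eq_square algebra_simps)
  show s2: "s\<^sup>2 = 16 * p\<^sup>2 - 8 * p + 5" unfolding s sq by simp
  have "sqrt (2\<^sup>2) \<le> s" unfolding s sq by (intro real_sqrt_le_mono) simp
  then show s_ge: "2 \<le> s" by simp
  have halve: "2 / y / 2 = 1 / y" for y :: real by simp
  have A: "3 - 4 * p + s > 0" and B: "1 + 4 * p + s > 0" using p s_ge by auto
  have ss: "s * s = 16 * (p * p) - 8 * p + 5" using s2 by (simp add: power2_eq_square)
  show "2 / (3 - 4 * p + s) + 2 / (1 + 4 * p + s) = 1"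
    using A B ss by (simp add: divide_simps) (simp add: algebra_simps)
  \<comment> \<open>The product of the two denominators is linear in \<open>s\<close>, so the
    stationarity equations become polynomial identities that follow from \<open>ss\<close>.\<close>
  have AB: "(3 - 4 * p + s) * (1 + 4 * p + s) = 8 + 4 * s"
    using ss by (simp add: algebra_simps)
  show "p + (1 / 2 - p) * (2 / (1 + 4 * p + s)) = (1 + s) / 4 * (2 / (3 - 4 * p + s))"
  proof -
    have "2 * p * (8 + 4 * s) + 2 * (1 - 2 * p) * (3 - 4 * p + s) = (1 + s) * (1 + 4 * p + s)"
      using ss by (simp add: algebra_simps)
    then have "2 * p * ((3 - 4 * p + s) * (1 + 4 * p + s)) + 2 * (1 - 2 * p) * (3 - 4 * p + s) = (1 + s) * (1 + 4 * p + s)"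
      unfolding AB .
    then show ?thesis using A B by (simp add: divide_simps) (simp add: algebra_simps)
  qed
  show "(1 / 2 - p) + p * (2 / (3 - 4 * p + s)) = (1 + s) / 4 * (2 / (1 + 4 * p + s))"
  proof -
    have "(1 - 2 * p) * (8 + 4 * s) + 4 * p * (1 + 4 * p + s) = (1 + s) * (3 - 4 * p + s)"
      using ss by (simp add: algebra_simps)
    then have "(1 - 2 * p) * ((3 - 4 * p + s) * (1 + 4 * p + s)) + 4 * p * (1 + 4 * p + s) = (1 + s) * (3 - 4 * p + s)"
      unfolding AB .
    then show ?thesis using A B by (simp add: divide_simps) (simp add: algebra_simps)
  qed
  show "(4 * p - 3 + s) / (4 * (4 * p - 1)) = 2 / (3 - 4 * p + s) / 2" if "p \<noteq> 1 / 4"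
  proof -
    have "(4 * p - 3 + s) * (3 - 4 * p + s) = 4 * (4 * p - 1)"
      using ss by (simp add: algebra_simps)
    moreover have "4 * (4 * p - 1) \<noteq> 0" using that by auto
    ultimately have "(4 * p - 3 + s) / (4 * (4 * p - 1)) = 1 / (3 - 4 * p + s)"
      using A by (subst frac_eq_eq) auto
    then show ?thesis unfolding halve .
  qed
  show "(4 * p + 1 - s) / (4 * (4 * p - 1)) = 2 / (1 + 4 * p + s) / 2" if "p \<noteq> 1 / 4"
  proof -
    have "(4 * p + 1 - s) * (1 + 4 * p + s) = 4 * (4 * p - 1)"
      using ss by (simp add: algebra_simps)
    moreover have "4 * (4 * p - 1) \<noteq> 0" using that by auto
    ultimately have "(4 * p + 1 - s) / (4 * (4 * p - 1)) = 1 / (1 + 4 * p + s)"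
      using B by (subst frac_eq_eq) auto
    then show ?thesis unfolding halve .
  qed
  show "(1 / 4 - p * (1 / 2 - p)) / ((1 + s) / 4) = - 1 / 4 + 1 / 4 * s"
  proof -
    have "1 / 4 - p * (1 / 2 - p) = (- 1 / 4 + 1 / 4 * s) * ((1 + s) / 4)"
      using ss by (simp add: field_simps)
    then show ?thesis using s_ge by simp
  qed
qed

theorem mainTheorem9:
  fixes \<alpha> \<beta> :: int
    and a a2 b b2 :: "bool \<times> int"
    and \<mu> :: "(bool \<times> int) list pmf"
    and p :: real
    and M :: "'w measure"
    and x :: "nat \<Rightarrow> 'w \<Rightarrow> (bool \<times> int) list"
    and r :: "bool \<times> int \<Rightarrow> real"
  assumes gen_\<alpha>: "generate Z3 {\<alpha>} = carrier Z3"
    and gen_\<beta>: "generate Z3 {\<beta>} = carrier Z3"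
    and a: "a = (False, \<alpha>)" and a2: "a2 = (False, \<alpha> \<otimes>\<^bsub>Z3\<^esub> \<alpha>)"
    and b: "b = (True, \<beta>)" and b2: "b2 = (True, \<beta> \<otimes>\<^bsub>Z3\<^esub> \<beta>)"
    and p: "0 \<le> p" "p \<le> 1 / 2"
    and supp_\<mu>: "set_pmf \<mu> \<subseteq> {[a], [a2], [b], [b2]}"
    and \<mu>: "pmf \<mu> [a] = p" "pmf \<mu> [b] = p" "pmf \<mu> [a2] = 1 / 2 - p" "pmf \<mu> [b2] = 1 / 2 - p"
    and steps: "random_walk_steps M \<mu> x"
    and r: "r a = (4 * p - 3 + sqrt (16 * p\<^sup>2 - 8 * p + 5)) / (4 * (4 * p - 1))"
      "r b = (4 * p - 3 + sqrt (16 * p\<^sup>2 - 8 * p + 5)) / (4 * (4 * p - 1))"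
      "r a2 = (4 * p + 1 - sqrt (16 * p\<^sup>2 - 8 * p + 5)) / (4 * (4 * p - 1))"
      "r b2 = (4 * p + 1 - sqrt (16 * p\<^sup>2 - 8 * p + 5)) / (4 * (4 * p - 1))"
  shows "has_drift M (walk Z3_Z3 x) (- 1 / 4 + 1 / 4 * sqrt (16 * p\<^sup>2 - 8 * p + 5)) \<and>
    (p \<noteq> 1 / 4 \<longrightarrow>
      (\<exists>!\<nu>. harmonic_measure M {a, a2, b, b2} (walk Z3_Z3 x) \<nu>) \<and>
      (\<forall>\<nu>. harmonic_measure M {a, a2, b, b2} (walk Z3_Z3 x) \<nu> \<longrightarrow>
        markovian_multiplicative {a, a2, b, b2} r \<nu>))"
proof -
  define s where "s = sqrt (16 * p\<^sup>2 - 8 * p + 5)"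
  note w = weight_identities[OF p s_def]
  have in_letters: "a \<in> letters" "b \<in> letters" and bars: "a2 = bar a" "b2 = bar b"
    unfolding a b a2 b2 using generator_Z3[OF gen_\<alpha>] generator_Z3[OF gen_\<beta>] by auto
  have distinct: "a \<noteq> b" "a2 \<noteq> b" "a \<noteq> b2" "a2 \<noteq> b2" by (auto simp: a b a2 b2)
  have letters: "letters = {a, a2, b, b2}"
  proof
    show "letters \<subseteq> {a, a2, b, b2}"
    proof
      fix l assume l: "l \<in> letters"
      have "fst a = fst l \<or> fst b = fst l" by (simp add: a b)
      then show "l \<in> {a, a2, b, b2}"
        using letters_same_factor[OF in_letters(1) l] letters_same_factor[OF in_letters(2) l] bars by auto
    qed
  qed (use in_letters bars in auto)
  define R where "R l = (if l = a \<or> l = b then 2 / (3 - 4 * p + s) else 2 / (1 + 4 * p + s))" for l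
  have R: "R a = 2 / (3 - 4 * p + s)" "R b = 2 / (3 - 4 * p + s)"
    "R a2 = 2 / (1 + 4 * p + s)" "R b2 = 2 / (1 + 4 * p + s)"
    using distinct bars by (auto simp: R_def)
  have bar2: "bar a = a2" "bar a2 = a" "bar b = b2" "bar b2 = b" by (simp_all add: bars)
  have pos: "3 - 4 * p + s > 0" "1 + 4 * p + s > 0" using p w(2) by auto
  have weights: "z3_weights (\<lambda>l. pmf \<mu> [l]) R ((1 + s) / 4) (p * (1 / 2 - p))"
  proof
    fix l assume "l \<in> letters"
    then consider "l = a" | "l = a2" | "l = b" | "l = b2" by (auto simp: letters)
    note cases = this
    show "0 \<le> pmf \<mu> [l]" by simp
    show "pmf \<mu> [l] + pmf \<mu> [bar l] = 1 / 2" by (cases rule: cases) (simp_all add: bar2 \<mu>)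
    show "pmf \<mu> [l] * pmf \<mu> [bar l] = p * (1 / 2 - p)" by (cases rule: cases) (simp_all add: bar2 \<mu>)
    show "0 < R l" using pos by (cases rule: cases) (simp_all add: R)
    show "R l + R (bar l) = 1" using w(3) by (cases rule: cases) (simp_all add: bar2 R add.commute)
    show "pmf \<mu> [l] + pmf \<mu> [bar l] * R (bar l) = (1 + s) / 4 * R l"
      by (cases rule: cases) (simp_all only: bar2 \<mu> R w(4,5))
  qed
  have supp: "set_pmf \<mu> \<subseteq> (\<lambda>l. [l]) ` letters" using supp_\<mu> by (auto simp: letters)
  interpret z3_walk M "\<lambda>l. pmf \<mu> [l]" R "(1 + s) / 4" "p * (1 / 2 - p)" "\<lambda>n \<omega>. hd (x n \<omega>)"
    by (rule z3_walk_random_walk_steps[OF steps supp weights])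
  have walk: "AE \<omega> in M. \<forall>n. walk Z3_Z3 x n \<omega> = rev (stack n \<omega>)"
    by (rule walk_eq_rev_stack[OF z3_walk_axioms random_walk_steps_AE_singleton[OF steps supp]])
  have "has_drift M (walk Z3_Z3 x) (- 1 / 4 + 1 / 4 * s)"
    unfolding has_drift_def using AE_length_speed walk
    by eventually_elim (simp only: w(8) length_rev)
  moreover have "markovian_multiplicative letters r (distr M (infinite_words letters) lim_word)" if "p \<noteq> 1 / 4"
  proof (rule markovian_multiplicative_lim_word)
    fix l assume "l \<in> letters"
    then consider "l = a" | "l = a2" | "l = b" | "l = b2" by (auto simp: letters)
    then show "r l = R l / 2"
      by cases (simp_all only: r R s_def[symmetric] w(6)[OF that] w(7)[OF that])
  qed
  ultimately show ?thesis
    unfolding letters[symmetric] s_def[symmetric] harmonic_measure_iff[OF walk] by simp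
qed

end
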